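(* The in-degree quiver polynomials are invariants, in the following sense. (a) If $X$ is a finite psyquandle and $S\subset\mathrm{Hom}(X,X)$ a set of psyquandle endomorphisms, then $\Phi_X^{\deg^+,S}(L)=\sum_{f\in V(\mathcal{PQ}_X^S(L))}u^{\deg^+(f)}$ is an invariant of oriented singular knots and links $L$ (equal for diagrams related by oriented singular Reidemeister moves). (b) If $X$ is a finite pI-adequate psyquandle and $S\subset\mathrm{Hom}(X,X)$ a set of psyquandle endomorphisms, then $\Phi_X^{\deg^+,S}(L)=\sum_{f\in V(\mathcal{PQ}_X^S(L))}u^{\deg^+(f)}$ is an invariant of oriented pseudoknots $L$ (equal for diagrams related by oriented pseudoknot Reidemeister moves). (c) If $X$ is a finite biquandle and $S\subset\mathrm{Hom}(X,X)$ a set of biquandle endomorphisms, then $\Phi_X^{\deg^+,S}(L)=\sum_{f\in V(\mathcal{BQ}_X^S(L))}u^{\deg^+(f)}$ is an invariant of oriented classical and virtual knots and links $L$ (equal for diagrams related by oriented classical, respectively classical and virtual, Reidemeister moves).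
   Context: **Psyquandles.** A psyquandle is a set $X$ with four binary operations $\underline{\triangleright},\overline{\triangleright},\underline{\bullet},\overline{\bullet}$ such that: (0) Each operation $*$ of the four is right-invertible: there is an operation $*^{-1}$ with $(x*y)*^{-1}y=x=(x*^{-1}y)*y$ for all $x,y\in X$. (i) $x\,\underline{\triangleright}\,x=x\,\overline{\triangleright}\,x$ for all $x\in X$. (ii) The maps $X\times X\to X\times X$, $(x,y)\mapsto(y\,\overline{\triangleright}\,x,\;x\,\underline{\triangleright}\,y)$ and $(x,y)\mapsto(y\,\overline{\bullet}\,x,\;x\,\underline{\bullet}\,y)$, are invertible. (iii) For all $x,y,z\in X$: $(x\underline{\triangleright}y)\underline{\triangleright}(z\underline{\triangleright}y)=(x\underline{\triangleright}z)\underline{\triangleright}(y\overline{\triangleright}z)$, $(x\underline{\triangleright}y)\overline{\triangleright}(z\underline{\triangleright}y)=(x\overline{\triangleright}z)\underline{\triangleright}(y\overline{\triangleright}z)$, $(x\overline{\triangleright}y)\overline{\triangleright}(z\overline{\triangleright}y)=(x\overline{\triangleright}z)\overline{\triangleright}(y\underline{\triangleright}z)$. (iv) For all $x,y\in X$: $x\,\underline{\bullet}\,((y\overline{\triangleright}x)\overline{\bullet}^{-1}x)=[(x\underline{\triangleright}y)\overline{\bullet}^{-1}y]\,\overline{\triangleright}\,[(y\overline{\triangleright}x)\overline{\bullet}^{-1}x]$, $y\,\underline{\bullet}\,((x\underline{\triangleright}y)\overline{\bullet}^{-1}y)=[(y\overline{\triangleright}x)\overline{\bullet}^{-1}x]\,\underline{\triangleright}\,[(x\underline{\triangleright}y)\overline{\bullet}^{-1}y]$.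 (v) For all $x,y,z\in X$: $(x\overline{\triangleright}y)\overline{\triangleright}(z\overline{\bullet}y)=(x\overline{\triangleright}z)\overline{\triangleright}(y\underline{\bullet}z)$, $(x\underline{\triangleright}y)\underline{\triangleright}(z\overline{\bullet}y)=(x\underline{\triangleright}z)\underline{\triangleright}(y\underline{\bullet}z)$, $(x\overline{\triangleright}y)\overline{\bullet}(z\overline{\triangleright}y)=(x\overline{\bullet}z)\overline{\triangleright}(y\underline{\triangleright}z)$, $(x\underline{\triangleright}y)\underline{\bullet}(z\underline{\triangleright}y)=(x\underline{\bullet}z)\underline{\triangleright}(y\overline{\triangleright}z)$, $(x\overline{\triangleright}y)\underline{\bullet}(z\overline{\triangleright}y)=(x\underline{\bullet}z)\overline{\triangleright}(y\underline{\triangleright}z)$, $(x\underline{\triangleright}y)\overline{\bullet}(z\underline{\triangleright}y)=(x\overline{\bullet}z)\underline{\triangleright}(y\overline{\triangleright}z)$. A psyquandle is pI-adequate if also $x\,\underline{\bullet}\,x=x\,\overline{\bullet}\,x$ for all $x\in X$. A biquandle is a set with two operations $\underline{\triangleright},\overline{\triangleright}$ satisfying the parts of (0)–(iii) that involve only these two operations. Homomorphisms of psyquandles (biquandles) are maps preserving all four (both) operations; endomorphisms are homomorphisms $X\to X$, and $\mathrm{Hom}(X,X)$ is the set of these. **Diagrams and moves.** An oriented singular knot/link diagram is an oriented planar knot/link diagram with classical crossings and singular crossings (transverse double points, regarded as rigid 4-valent vertices). Oriented singular Reidemeister moves: the classical moves I, II, III; sliding a strand entirely over, or entirely under, a singular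 crossing; and exchanging a singular crossing and an adjacent classical crossing of the same two strands ("singular crossing followed by classical crossing" $\leftrightarrow$ "classical crossing of the same sign followed by singular crossing"); all with all orientations. Pseudoknot diagrams have precrossings (crossings with unknown over/under information, drawn as transverse double points) in place of singular crossings; the pseudoknot Reidemeister moves are the singular Reidemeister moves with precrossings in place of singular crossings, plus the move pI, which adds or removes a Reidemeister-I-type kink whose crossing is a precrossing. Virtual link diagrams have classical crossings and virtual crossings; the moves are the classical Reidemeister moves and the virtual Reidemeister moves (equivalently, the detour move: an arc containing only virtual crossings may be replaced by any other arc with the same endpoints whose crossings with the rest of the diagram are all virtual). Knots, links, pseudoknots, etc. are equivalence classes of diagrams under planar isotopy and the respective moves. **Colorings.** A semiarc is a portion of the diagram between two consecutive crossing points (classical over, classical under, singular or precrossing; virtual crossings are ignored); a component without such crossings is one semiarc. Draw each crossing with both strands oriented upward; each strand meets one semiarc on the left (bottom-left or top-left) and one on the right. An $X$-coloring assigns an element of $X$ to each semiarc such that: * at each classical crossing (of either sign), if $x$ is the left label of the under-strand and $y$ the left label of the over-strand, then the right label of the under-strand is $x\,\underline{\triangleright}\,y$ and the right label of the over-strand is $y\,\overline{\triangleright}\,x$; * at each singular crossing or precrossing, if $x$ is the left label of the strand running from bottom-left to top-right and $y$ is the left label of the strand running from bottom-right to top-left, then their right labels are $x\,\underline{\bullet}\,y$ and $y\,\overline{\bullet}\,x$ respectively. For classical and virtual diagrams only the first rule is used, and $X$ need only be a biquandle. Colorings are identified with homomorphisms to $X$ from the fundamental psyquandle (pI-adequate psyquandle,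 biquandle) of the diagram, i.e. the free such object on the semiarcs modulo the relations imposed by the rules at the crossings. **Quivers and polynomials.** $\mathcal{PQ}_X^S(L)$ (or $\mathcal{BQ}_X^S(L)$ in the biquandle case) is the directed multigraph (loops and multiple edges allowed) with one vertex for each $X$-coloring $f$ of $L$ and, for each vertex $f$ and each $\phi\in S$, one edge directed from $f$ to $\phi f=\phi\circ f$ (apply $\phi$ to every label). $V(\cdot)$ denotes the vertex set, $\deg^+(f)$ denotes the in-degree of $f$ (the number of edges directed into $f$), and $u$ is a formal variable. *)

theory Defs
  imports
    "HOL-Library.FuncSet"
    "HOL-Computational_Algebra.Polynomial"
    "Graph_Theory.Digraph"
begin

section \<open>Biquandles and psyquandles\<close>

text \<open>The subscripts \<open>u\<close> and \<open>o\<close> stand for the underlined and the overlined operation.\<close>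

record 'a biq =
  carrier :: "'a set"
  utri :: "'a \<Rightarrow> 'a \<Rightarrow> 'a"  (infixl \<open>\<rhd>\<^sub>u\<index>\<close> 70)
  otri :: "'a \<Rightarrow> 'a \<Rightarrow> 'a"  (infixl \<open>\<rhd>\<^sub>o\<index>\<close> 70)

record 'a psyq = "'a biq" +
  ubul :: "'a \<Rightarrow> 'a \<Rightarrow> 'a"  (infixl \<open>\<bullet>\<^sub>u\<index>\<close> 70)
  obul :: "'a \<Rightarrow> 'a \<Rightarrow> 'a"  (infixl \<open>\<bullet>\<^sub>o\<index>\<close> 70)

definition binop_on :: "'a set \<Rightarrow> ('a \<Rightarrow> 'a \<Rightarrow> 'a) \<Rightarrow> bool" where
  "binop_on A f \<longleftrightarrow> (\<forall>x\<in>A. \<forall>y\<in>A. f x y \<in> A)"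

definition right_invertible :: "'a set \<Rightarrow> ('a \<Rightarrow> 'a \<Rightarrow> 'a) \<Rightarrow> bool" where
  "right_invertible A f \<longleftrightarrow>
    (\<exists>g. binop_on A g \<and> (\<forall>x\<in>A. \<forall>y\<in>A. g (f x y) y = x \<and> f (g x y) y = x))"

text \<open>If \<open>f\<close> is right-invertible on \<open>A\<close>, the operation \<open>g\<close> above is unique on \<open>A\<close> and
  equal to the following one.\<close>

definition rinv :: "'a set \<Rightarrow> ('a \<Rightarrow> 'a \<Rightarrow> 'a) \<Rightarrow> 'a \<Rightarrow> 'a \<Rightarrow> 'a" where
  "rinv A f x y = inv_into A (\<lambda>z. f z y) x"

abbreviation obul_inv :: "('a, 'm) psyq_scheme \<Rightarrow> 'a \<Rightarrow> 'a \<Rightarrow> 'a"  (infixl \<open>\<bullet>\<^sub>o\<inverse>\<index>\<close> 70) where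
  "x \<bullet>\<^sub>o\<inverse>\<^bsub>X\<^esub> y \<equiv> rinv (carrier X) (obul X) x y"

definition pair_invertible :: "'a set \<Rightarrow> ('a \<Rightarrow> 'a \<Rightarrow> 'a) \<Rightarrow> ('a \<Rightarrow> 'a \<Rightarrow> 'a) \<Rightarrow> bool" where
  "pair_invertible A u v \<longleftrightarrow> bij_betw (\<lambda>(x, y). (v y x, u x y)) (A \<times> A) (A \<times> A)"

locale biquandle =
  fixes X :: "('a, 'm) biq_scheme" (structure)
  assumes tri_closed:
      "binop_on (carrier X) (utri X)" "binop_on (carrier X) (otri X)"
    and tri_right_invertible:
      "right_invertible (carrier X) (utri X)" "right_invertible (carrier X) (otri X)"
    and tri_diag:
      "x \<in> carrier X \<Longrightarrow> x \<rhd>\<^sub>u x = x \<rhd>\<^sub>o x"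
    and tri_pair_invertible:
      "pair_invertible (carrier X) (utri X) (otri X)"
    and exchange:
      "\<lbrakk>x \<in> carrier X; y \<in> carrier X; z \<in> carrier X\<rbrakk> \<Longrightarrow>
        (x \<rhd>\<^sub>u y) \<rhd>\<^sub>u (z \<rhd>\<^sub>u y) = (x \<rhd>\<^sub>u z) \<rhd>\<^sub>u (y \<rhd>\<^sub>o z)"
      "\<lbrakk>x \<in> carrier X; y \<in> carrier X; z \<in> carrier X\<rbrakk> \<Longrightarrow>
        (x \<rhd>\<^sub>u y) \<rhd>\<^sub>o (z \<rhd>\<^sub>u y) = (x \<rhd>\<^sub>o z) \<rhd>\<^sub>u (y \<rhd>\<^sub>o z)"
      "\<lbrakk>x \<in> carrier X; y \<in> carrier X; z \<in> carrier X\<rbrakk> \<Longrightarrow>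
        (x \<rhd>\<^sub>o y) \<rhd>\<^sub>o (z \<rhd>\<^sub>o y) = (x \<rhd>\<^sub>o z) \<rhd>\<^sub>o (y \<rhd>\<^sub>u z)"

locale psyquandle = biquandle X for X :: "('a, 'm) psyq_scheme" (structure) +
  assumes bul_closed:
      "binop_on (carrier X) (ubul X)" "binop_on (carrier X) (obul X)"
    and bul_right_invertible:
      "right_invertible (carrier X) (ubul X)" "right_invertible (carrier X) (obul X)"
    and bul_pair_invertible:
      "pair_invertible (carrier X) (ubul X) (obul X)"
    and bul_tri_swap:
      "\<lbrakk>x \<in> carrier X; y \<in> carrier X\<rbrakk> \<Longrightarrow>
        x \<bullet>\<^sub>u ((y \<rhd>\<^sub>o x) \<bullet>\<^sub>o\<inverse> x) = ((x \<rhd>\<^sub>u y) \<bullet>\<^sub>o\<inverse> y) \<rhd>\<^sub>o ((y \<rhd>\<^sub>o x) \<bullet>\<^sub>o\<inverse> x)"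
      "\<lbrakk>x \<in> carrier X; y \<in> carrier X\<rbrakk> \<Longrightarrow>
        y \<bullet>\<^sub>u ((x \<rhd>\<^sub>u y) \<bullet>\<^sub>o\<inverse> y) = ((y \<rhd>\<^sub>o x) \<bullet>\<^sub>o\<inverse> x) \<rhd>\<^sub>u ((x \<rhd>\<^sub>u y) \<bullet>\<^sub>o\<inverse> y)"
    and mixed_exchange:
      "\<lbrakk>x \<in> carrier X; y \<in> carrier X; z \<in> carrier X\<rbrakk> \<Longrightarrow>
        (x \<rhd>\<^sub>o y) \<rhd>\<^sub>o (z \<bullet>\<^sub>o y) = (x \<rhd>\<^sub>o z) \<rhd>\<^sub>o (y \<bullet>\<^sub>u z)"
      "\<lbrakk>x \<in> carrier X; y \<in> carrier X; z \<in> carrier X\<rbrakk> \<Longrightarrow>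
        (x \<rhd>\<^sub>u y) \<rhd>\<^sub>u (z \<bullet>\<^sub>o y) = (x \<rhd>\<^sub>u z) \<rhd>\<^sub>u (y \<bullet>\<^sub>u z)"
      "\<lbrakk>x \<in> carrier X; y \<in> carrier X; z \<in> carrier X\<rbrakk> \<Longrightarrow>
        (x \<rhd>\<^sub>o y) \<bullet>\<^sub>o (z \<rhd>\<^sub>o y) = (x \<bullet>\<^sub>o z) \<rhd>\<^sub>o (y \<rhd>\<^sub>u z)"
      "\<lbrakk>x \<in> carrier X; y \<in> carrier X; z \<in> carrier X\<rbrakk> \<Longrightarrow>
        (x \<rhd>\<^sub>u y) \<bullet>\<^sub>u (z \<rhd>\<^sub>u y) = (x \<bullet>\<^sub>u z) \<rhd>\<^sub>u (y \<rhd>\<^sub>o z)"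
      "\<lbrakk>x \<in> carrier X; y \<in> carrier X; z \<in> carrier X\<rbrakk> \<Longrightarrow>
        (x \<rhd>\<^sub>o y) \<bullet>\<^sub>u (z \<rhd>\<^sub>o y) = (x \<bullet>\<^sub>u z) \<rhd>\<^sub>o (y \<rhd>\<^sub>u z)"
      "\<lbrakk>x \<in> carrier X; y \<in> carrier X; z \<in> carrier X\<rbrakk> \<Longrightarrow>
        (x \<rhd>\<^sub>u y) \<bullet>\<^sub>o (z \<rhd>\<^sub>u y) = (x \<bullet>\<^sub>o z) \<rhd>\<^sub>u (y \<rhd>\<^sub>o z)"

locale pI_adequate_psyquandle = psyquandle X for X :: "('a, 'm) psyq_scheme" (structure) +
  assumes bul_diag: "x \<in> carrier X \<Longrightarrow> x \<bullet>\<^sub>u x = x \<bullet>\<^sub>o x"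

text \<open>Homomorphisms are extensional functions, so that distinct elements of a set of
  homomorphisms are distinct as maps between the carriers.\<close>

definition biq_hom :: "('a, 'm) biq_scheme \<Rightarrow> ('b, 'n) biq_scheme \<Rightarrow> ('a \<Rightarrow> 'b) set" where
  "biq_hom X Y = {h \<in> carrier X \<rightarrow>\<^sub>E carrier Y. \<forall>x\<in>carrier X. \<forall>y\<in>carrier X.
     h (x \<rhd>\<^sub>u\<^bsub>X\<^esub> y) = h x \<rhd>\<^sub>u\<^bsub>Y\<^esub> h y \<and> h (x \<rhd>\<^sub>o\<^bsub>X\<^esub> y) = h x \<rhd>\<^sub>o\<^bsub>Y\<^esub> h y}"

definition psyq_hom :: "('a, 'm) psyq_scheme \<Rightarrow> ('b, 'n) psyq_scheme \<Rightarrow> ('a \<Rightarrow> 'b) set" where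
  "psyq_hom X Y = {h \<in> biq_hom X Y. \<forall>x\<in>carrier X. \<forall>y\<in>carrier X.
     h (x \<bullet>\<^sub>u\<^bsub>X\<^esub> y) = h x \<bullet>\<^sub>u\<^bsub>Y\<^esub> h y \<and> h (x \<bullet>\<^sub>o\<^bsub>X\<^esub> y) = h x \<bullet>\<^sub>o\<^bsub>Y\<^esub> h y}"


section \<open>Oriented planar diagrams\<close>

text \<open>
  A diagram in the plane is put in general position with respect to the height function, so
  that its crossings, local minima and local maxima lie at pairwise different heights, and is
  cut by horizontal lines into slices that contain exactly one of these each. Every diagram is
  planar isotopic to one in general position, and a planar isotopy between two such diagrams
  can be chosen to stay in general position except for finitely many of the events listed in
  \<open>planar_isotopy\<close> below.

  A diagram is the list of its slices from bottom to top. A slice \<open>(l, e, r)\<close> consists of one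
  elementary piece \<open>e\<close>, vertical strands with directions \<open>l\<close> to its left, and vertical strands
  with directions \<open>r\<close> to its right.

  The piece \<open>Crossing k a b\<close> has a strand with direction \<open>a\<close> on the line from its south-west to
  its north-east corner, and a strand with direction \<open>b\<close> on the line from its south-east to its
  north-west corner. For \<open>k = Over\<close> (\<open>Under\<close>) it is a classical crossing at which the strand on
  the south-west to north-east line is the over-strand (under-strand). The piece \<open>Cup d\<close>
  (\<open>Cap d\<close>) is a local minimum (maximum) whose left leg has direction \<open>d\<close>.
\<close>

datatype dir = Up | Down

fun opp :: "dir \<Rightarrow> dir" where
  "opp Up = Down"
| "opp Down = Up"

datatype kind = Over | Under | Singular | Precrossing | Virtual

datatype piece = Crossing kind dir dir | Cup dir | Cap dir

type_synonym slice = "dir list \<times> piece \<times> dir list"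
type_synonym tangle = "slice list"

fun piece_bot :: "piece \<Rightarrow> dir list" where
  "piece_bot (Crossing k a b) = [a, b]"
| "piece_bot (Cup d) = []"
| "piece_bot (Cap d) = [d, opp d]"

fun piece_top :: "piece \<Rightarrow> dir list" where
  "piece_top (Crossing k a b) = [b, a]"
| "piece_top (Cup d) = [d, opp d]"
| "piece_top (Cap d) = []"

fun slice_bot :: "slice \<Rightarrow> dir list" where
  "slice_bot (l, e, r) = l @ piece_bot e @ r"

fun slice_top :: "slice \<Rightarrow> dir list" where
  "slice_top (l, e, r) = l @ piece_top e @ r"

definition closed_tangle :: "tangle \<Rightarrow> bool" where
  "closed_tangle D \<longleftrightarrow>
    (D \<noteq> [] \<longrightarrow> slice_bot (hd D) = [] \<and> slice_top (last D) = []) \<and>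
    (\<forall>i. Suc i < length D \<longrightarrow> slice_top (D ! i) = slice_bot (D ! Suc i))"

definition diagram :: "kind set \<Rightarrow> tangle \<Rightarrow> bool" where
  "diagram K D \<longleftrightarrow> closed_tangle D \<and> (\<forall>l k a b r. (l, Crossing k a b, r) \<in> set D \<longrightarrow> k \<in> K)"

abbreviation "classical_diagram \<equiv> diagram {Over, Under}"
abbreviation "singular_diagram \<equiv> diagram {Over, Under, Singular}"
abbreviation "pseudo_diagram \<equiv> diagram {Over, Under, Precrossing}"
abbreviation "virtual_diagram \<equiv> diagram {Over, Under, Virtual}"


section \<open>Planar isotopy and Reidemeister moves\<close>

text \<open>A local move replaces a tangle by another one with the same endpoints; \<open>pad l r\<close> puts
  vertical strands to the left and to the right of a tangle. The empty tangle \<open>[]\<close> stands for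
  any number of vertical strands.\<close>

definition pad :: "dir list \<Rightarrow> dir list \<Rightarrow> tangle \<Rightarrow> tangle" where
  "pad l r = map (\<lambda>(l', e, r'). (l @ l', e, r' @ r))"

definition apply_move :: "kind set \<Rightarrow> (tangle \<Rightarrow> tangle \<Rightarrow> bool) \<Rightarrow> tangle \<Rightarrow> tangle \<Rightarrow> bool" where
  "apply_move K R D D' \<longleftrightarrow> diagram K D \<and> diagram K D' \<and>
    (\<exists>below above l r T T'. R T T' \<and>
       D = below @ pad l r T @ above \<and> D' = below @ pad l r T' @ above)"

text \<open>\<open>flip k\<close> describes the crossing of kind \<open>k\<close> after its two strands have exchanged the roles
  of south-west to north-east and south-east to north-west strand.\<close>

fun flip :: "kind \<Rightarrow> kind" where
  "flip Over = Under"
| "flip Under = Over"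
| "flip Singular = Singular"
| "flip Precrossing = Precrossing"
| "flip Virtual = Virtual"

text \<open>The events in a generic planar isotopy: two pieces exchange their heights; a minimum and a
  maximum that are adjacent on a strand cancel; a maximum or a minimum of one strand passes
  through a crossing of this strand with a strand of direction \<open>b\<close>, so that the crossing
  turns by a quarter.\<close>

inductive planar_isotopy :: "tangle \<Rightarrow> tangle \<Rightarrow> bool" where
  exchange_heights:
    "planar_isotopy
       [([], e, m @ piece_bot e'), (piece_top e @ m, e', [])]
       [(piece_bot e @ m, e', []), ([], e, m @ piece_top e')]"
| zigzag_right:
    "planar_isotopy [([d], Cup (opp d), []), ([], Cap d, [d])] []"
| zigzag_left:
    "planar_isotopy [([], Cup d, [d]), ([d], Cap (opp d), [])] []"
| turn_cap:
    "planar_isotopy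
       [([], Crossing k a b, [opp a]), ([b], Cap a, [])]
       [([a], Crossing (flip k) b (opp a), []), ([], Cap a, [b])]"
| turn_cup:
    "planar_isotopy
       [([b], Cup a, []), ([], Crossing k b a, [opp a])]
       [([], Cup a, [b]), ([a], Crossing (flip k) (opp a) b, [])]"

text \<open>The Reidemeister I kink with crossing of kind \<open>k\<close> and loop on the right or on the left.\<close>

inductive kink :: "kind \<Rightarrow> tangle \<Rightarrow> tangle \<Rightarrow> bool" for k where
  "kink k [([d], Cup d, []), ([], Crossing k d d, [opp d]), ([d], Cap d, [])] []"
| "kink k [([], Cup (opp d), [d]), ([opp d], Crossing k d d, []), ([], Cap (opp d), [d])] []"

text \<open>Two adjacent crossings of the same two strands cancel.\<close>

inductive bigon :: "kind \<Rightarrow> tangle \<Rightarrow> tangle \<Rightarrow> bool" for k where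
  "bigon k [([], Crossing k a b, []), ([], Crossing (flip k) b a, [])] []"

text \<open>Three strands that start in the order 1, 2, 3 from left to right and end in reverse order;
  strand 1 passes from one side of the crossing of 2 and 3 to the other. The index \<open>kij\<close> is the
  kind of the crossing of strands \<open>i\<close> and \<open>j\<close>; for \<open>i < j\<close>, strand \<open>i\<close> is its south-west to
  north-east strand.\<close>

inductive triangle :: "kind \<Rightarrow> kind \<Rightarrow> kind \<Rightarrow> tangle \<Rightarrow> tangle \<Rightarrow> bool" for k12 k13 k23 where
  "triangle k12 k13 k23
     [([], Crossing k12 a b, [c]), ([b], Crossing k13 a c, []), ([], Crossing k23 b c, [a])]
     [([a], Crossing k23 b c, []), ([], Crossing k13 a c, [b]), ([c], Crossing k12 a b, [])]"

text \<open>One of the three strands is, with respect to both other strands, over (\<open>u = Over\<close>),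
  under (\<open>u = Under\<close>) or virtual (\<open>u = Virtual\<close>), and \<open>x\<close> is the kind of the crossing of the
  other two.\<close>

inductive slide :: "kind \<Rightarrow> kind \<Rightarrow> tangle \<Rightarrow> tangle \<Rightarrow> bool" for u x where
  strand_1: "triangle u u x T T' \<Longrightarrow> slide u x T T'"
| strand_2: "triangle (flip u) x u T T' \<Longrightarrow> slide u x T T'"
| strand_3: "triangle x (flip u) (flip u) T T' \<Longrightarrow> slide u x T T'"

inductive classical_move :: "tangle \<Rightarrow> tangle \<Rightarrow> bool" where
  R1: "k \<in> {Over, Under} \<Longrightarrow> kink k T T' \<Longrightarrow> classical_move T T'"
| R2: "k \<in> {Over, Under} \<Longrightarrow> bigon k T T' \<Longrightarrow> classical_move T T'"
| R3: "u \<in> {Over, Under} \<Longrightarrow> x \<in> {Over, Under} \<Longrightarrow> slide u x T T' \<Longrightarrow> classical_move T T'"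

text \<open>The moves that involve a transverse double point; \<open>s\<close> is \<open>Singular\<close> or \<open>Precrossing\<close>. In
  \<open>swap\<close>, both classical crossings have the same sign: passing from \<open>Crossing k a b\<close> to
  \<open>Crossing k b a\<close> either changes nothing or reverses both strands.\<close>

inductive transverse_move :: "kind \<Rightarrow> tangle \<Rightarrow> tangle \<Rightarrow> bool" for s where
  slide: "u \<in> {Over, Under} \<Longrightarrow> slide u s T T' \<Longrightarrow> transverse_move s T T'"
| swap: "k \<in> {Over, Under} \<Longrightarrow>
    transverse_move s
      [([], Crossing s a b, []), ([], Crossing k b a, [])]
      [([], Crossing k a b, []), ([], Crossing s b a, [])]"

inductive virtual_move :: "tangle \<Rightarrow> tangle \<Rightarrow> bool" where
  V1: "kink Virtual T T' \<Longrightarrow> virtual_move T T'"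
| V2: "bigon Virtual T T' \<Longrightarrow> virtual_move T T'"
| V3: "x \<in> {Over, Under, Virtual} \<Longrightarrow> slide Virtual x T T' \<Longrightarrow> virtual_move T T'"

definition classical_equivalent :: "tangle \<Rightarrow> tangle \<Rightarrow> bool" where
  "classical_equivalent = equivclp (apply_move {Over, Under}
     (\<lambda>T T'. planar_isotopy T T' \<or> classical_move T T'))"

definition singular_equivalent :: "tangle \<Rightarrow> tangle \<Rightarrow> bool" where
  "singular_equivalent = equivclp (apply_move {Over, Under, Singular}
     (\<lambda>T T'. planar_isotopy T T' \<or> classical_move T T' \<or> transverse_move Singular T T'))"

definition pseudo_equivalent :: "tangle \<Rightarrow> tangle \<Rightarrow> bool" where
  "pseudo_equivalent = equivclp (apply_move {Over, Under, Precrossing}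
     (\<lambda>T T'. planar_isotopy T T' \<or> classical_move T T' \<or> transverse_move Precrossing T T' \<or>
       kink Precrossing T T'))"

definition virtual_equivalent :: "tangle \<Rightarrow> tangle \<Rightarrow> bool" where
  "virtual_equivalent = equivclp (apply_move {Over, Under, Virtual}
     (\<lambda>T T'. planar_isotopy T T' \<or> classical_move T T' \<or> virtual_move T T'))"


section \<open>Semiarcs and colorings\<close>

text \<open>The point \<open>(i, j)\<close> is the \<open>j\<close>-th point from the left on the horizontal line below slice
  \<open>i\<close>. The line above the last slice of a closed tangle contains no points.\<close>

type_synonym point = "nat \<times> nat"

definition points :: "tangle \<Rightarrow> point set" where
  "points D = {(i, j). i < length D \<and> j < length (slice_bot (D ! i))}"

text \<open>Points joined inside one slice without meeting a classical crossing or a transverse double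
  point.\<close>

inductive joined :: "tangle \<Rightarrow> point \<Rightarrow> point \<Rightarrow> bool" for D where
  left: "i < length D \<Longrightarrow> D ! i = (l, e, r) \<Longrightarrow> j < length l \<Longrightarrow>
    joined D (i, j) (Suc i, j)"
| right: "i < length D \<Longrightarrow> D ! i = (l, e, r) \<Longrightarrow> j < length r \<Longrightarrow>
    joined D (i, length l + length (piece_bot e) + j) (Suc i, length l + length (piece_top e) + j)"
| cup: "i < length D \<Longrightarrow> D ! i = (l, Cup d, r) \<Longrightarrow>
    joined D (Suc i, length l) (Suc i, Suc (length l))"
| cap: "i < length D \<Longrightarrow> D ! i = (l, Cap d, r) \<Longrightarrow>
    joined D (i, length l) (i, Suc (length l))"
| virtual_sw_ne: "i < length D \<Longrightarrow> D ! i = (l, Crossing Virtual a b, r) \<Longrightarrow>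
    joined D (i, length l) (Suc i, Suc (length l))"
| virtual_se_nw: "i < length D \<Longrightarrow> D ! i = (l, Crossing Virtual a b, r) \<Longrightarrow>
    joined D (i, Suc (length l)) (Suc i, length l)"

definition semiarc :: "tangle \<Rightarrow> point \<Rightarrow> point set" where
  "semiarc D p = {q \<in> points D. equivclp (joined D) p q}"

definition semiarcs :: "tangle \<Rightarrow> point set set" where
  "semiarcs D = semiarc D ` points D"

text \<open>Turn a crossing with corners \<open>sw\<close>, \<open>se\<close>, \<open>nw\<close>, \<open>ne\<close> and strand directions \<open>a\<close>, \<open>b\<close>, as in
  \<open>Crossing k a b\<close>, so that both strands are oriented upward. The result is what is then at the
  bottom left, bottom right, top left and top right. The south-west to north-east strand becomes
  the bottom left to top right strand exactly if \<open>a = b\<close>.\<close>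

fun upright :: "dir \<Rightarrow> dir \<Rightarrow> 'a \<times> 'a \<times> 'a \<times> 'a \<Rightarrow> 'a \<times> 'a \<times> 'a \<times> 'a" where
  "upright Up Up (sw, se, nw, ne) = (sw, se, nw, ne)"
| "upright Down Down (sw, se, nw, ne) = (ne, nw, se, sw)"
| "upright Up Down (sw, se, nw, ne) = (nw, sw, ne, se)"
| "upright Down Up (sw, se, nw, ne) = (se, ne, sw, nw)"

text \<open>The semiarcs at the bottom left, bottom right, top left and top right of the crossing with
  strand directions \<open>a\<close>, \<open>b\<close> in slice \<open>i\<close>, to the right of \<open>n\<close> vertical strands.\<close>

definition corners ::
  "tangle \<Rightarrow> nat \<Rightarrow> nat \<Rightarrow> dir \<Rightarrow> dir \<Rightarrow> point set \<times> point set \<times> point set \<times> point set" where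
  "corners D i n a b = upright a b
     (semiarc D (i, n), semiarc D (i, Suc n), semiarc D (Suc i, n), semiarc D (Suc i, Suc n))"

definition biq_coloring :: "('a, 'm) biq_scheme \<Rightarrow> tangle \<Rightarrow> (point set \<Rightarrow> 'a) \<Rightarrow> bool" where
  "biq_coloring X D f \<longleftrightarrow> f \<in> semiarcs D \<rightarrow>\<^sub>E carrier X \<and>
    (\<forall>i l k a b r bl br tl tr.
       i < length D \<and> D ! i = (l, Crossing k a b, r) \<and>
       corners D i (length l) a b = (bl, br, tl, tr) \<longrightarrow>
       (k = (if a = b then Over else Under) \<longrightarrow>
          f br = f tl \<rhd>\<^sub>u\<^bsub>X\<^esub> f bl \<and> f tr = f bl \<rhd>\<^sub>o\<^bsub>X\<^esub> f tl) \<and>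
       (k = (if a = b then Under else Over) \<longrightarrow>
          f tr = f bl \<rhd>\<^sub>u\<^bsub>X\<^esub> f tl \<and> f br = f tl \<rhd>\<^sub>o\<^bsub>X\<^esub> f bl))"

definition psyq_coloring :: "('a, 'm) psyq_scheme \<Rightarrow> tangle \<Rightarrow> (point set \<Rightarrow> 'a) \<Rightarrow> bool" where
  "psyq_coloring X D f \<longleftrightarrow> biq_coloring X D f \<and>
    (\<forall>i l k a b r bl br tl tr.
       i < length D \<and> D ! i = (l, Crossing k a b, r) \<and> k \<in> {Singular, Precrossing} \<and>
       corners D i (length l) a b = (bl, br, tl, tr) \<longrightarrow>
       f tr = f bl \<bullet>\<^sub>u\<^bsub>X\<^esub> f tl \<and> f br = f tl \<bullet>\<^sub>o\<^bsub>X\<^esub> f bl)"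


section \<open>Coloring quivers and in-degree polynomials\<close>

type_synonym 'a quiver = "(point set \<Rightarrow> 'a, (point set \<Rightarrow> 'a) \<times> ('a \<Rightarrow> 'a)) pre_digraph"

definition coloring_quiver ::
  "tangle \<Rightarrow> (point set \<Rightarrow> 'a) set \<Rightarrow> ('a \<Rightarrow> 'a) set \<Rightarrow> 'a quiver" where
  "coloring_quiver D V S =
    \<lparr>verts = V, arcs = V \<times> S, tail = fst, head = (\<lambda>(f, h). compose (semiarcs D) h f)\<rparr>"

definition psyq_quiver :: "('a, 'm) psyq_scheme \<Rightarrow> ('a \<Rightarrow> 'a) set \<Rightarrow> tangle \<Rightarrow> 'a quiver" where
  "psyq_quiver X S D = coloring_quiver D {f. psyq_coloring X D f} S"

definition biq_quiver :: "('a, 'm) biq_scheme \<Rightarrow> ('a \<Rightarrow> 'a) set \<Rightarrow> tangle \<Rightarrow> 'a quiver" where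
  "biq_quiver X S D = coloring_quiver D {f. biq_coloring X D f} S"

definition in_degree_polynomial :: "('v, 'e) pre_digraph \<Rightarrow> int poly" where
  "in_degree_polynomial G = (\<Sum>f\<in>verts G. monom 1 (in_degree G f))"

end

theory Submission
  imports Defs
begin

text \<open>
  Label the points of a diagram line by line, from bottom to top: every slice is a relation between
  the labels on the line below it and on the line above it, and colorings are the sequences of
  label lists related in this way. Suppose that the two sides of a local move have fillings for the
  same labels on their bottom and top lines and that fillings are unique. Then the move induces a
  bijection of colorings. By uniqueness it commutes with every endomorphism, so it is an
  isomorphism of quivers that preserves in-degrees.

  For the triangle moves, turning all crossings by a quarter turn rotates the hexagon of boundary
  points, which reduces the eight orientations of the three strands to two. For these, one
  inclusion of boundary relations is a substitution into the axioms, and the other one follows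
  because the labels below a crossing determine those above it. Kinks use that squaring is
  injective, hence bijective on a finite carrier.
\<close>

section \<open>Switches and crossings\<close>

text \<open>Semiarcs are sets of points, and a move changes both the points and the way they are
  joined, so the colorings of two related diagrams have unrelated domains. Labels on lines avoid
  this: a move replaces one block of consecutive lines and keeps all others. Equal boundary
  relations alone would only match colorings in families; uniqueness of fillings makes the matching
  one-to-one.

  The main obstacle is the exchange of a double point with a classical crossing. The axioms give it
  directly for two upward strands and one kind of classical crossing. The other kind follows by
  composing with the inverse crossing, and two downward strands follow by a half turn. But a half
  turn maps each antiparallel exchange to itself, so these two are derived separately from the
  parallel one, by extracting square roots in the finite carrier.\<close>

definition side_rel :: "('a \<Rightarrow> 'a \<Rightarrow> 'a) \<Rightarrow> ('a \<Rightarrow> 'a \<Rightarrow> 'a) \<Rightarrow> 'a \<Rightarrow> 'a \<Rightarrow> 'a \<Rightarrow> 'a \<Rightarrow> bool" where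
  "side_rel u v p q r s \<longleftrightarrow> s = u p r \<and> q = v r p"

text \<open>Instances are the triangle operations, the bullet operations, the same pairs in
  exchanged order, and the two projections for virtual crossings. In
  \<open>side_rel u v p q r s\<close> the corners of an upright crossing are listed as bottom left,
  bottom right, top left, top right, so the left labels \<open>p\<close> and \<open>r\<close>
  produce the right labels.\<close>

locale switch =
  fixes A :: "'a set" and u v :: "'a \<Rightarrow> 'a \<Rightarrow> 'a"
  assumes closed: "binop_on A u" "binop_on A v"
    and rinv: "right_invertible A u" "right_invertible A v"
    and pair: "pair_invertible A u v"
begin

lemma closed_u [simp]: "x \<in> A \<Longrightarrow> y \<in> A \<Longrightarrow> u x y \<in> A"
  and closed_v [simp]: "x \<in> A \<Longrightarrow> y \<in> A \<Longrightarrow> v x y \<in> A"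
  using closed by (auto simp: binop_on_def)

lemma u_cancel: "\<lbrakk>x \<in> A; x' \<in> A; y \<in> A; u x y = u x' y\<rbrakk> \<Longrightarrow> x = x'"
  using rinv(1) unfolding right_invertible_def by metis

lemma v_cancel: "\<lbrakk>x \<in> A; x' \<in> A; y \<in> A; v x y = v x' y\<rbrakk> \<Longrightarrow> x = x'"
  using rinv(2) unfolding right_invertible_def by metis

lemma u_solve: assumes "x \<in> A" "y \<in> A" obtains z where "z \<in> A" "u z y = x"
  using rinv(1) assms unfolding right_invertible_def binop_on_def by metis

lemma v_solve: assumes "x \<in> A" "y \<in> A" obtains z where "z \<in> A" "v z y = x"
  using rinv(2) assms unfolding right_invertible_def binop_on_def by metis

lemma pair_cancel:
  assumes "x \<in> A" "y \<in> A" "x' \<in> A" "y' \<in> A" "v y x = v y' x'" "u x y = u x' y'"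
  shows "x = x'" "y = y'"
proof -
  have "inj_on (\<lambda>(x, y). (v y x, u x y)) (A \<times> A)"
    using pair by (auto simp: pair_invertible_def bij_betw_def)
  from inj_onD[OF this, of "(x, y)" "(x', y')"] show "x = x'" "y = y'"
    using assms by auto
qed

lemma pair_solve:
  assumes "p \<in> A" "q \<in> A" obtains x y where "x \<in> A" "y \<in> A" "v y x = p" "u x y = q"
proof -
  have "(p, q) \<in> (\<lambda>(x, y). (v y x, u x y)) ` (A \<times> A)"
    using pair assms by (auto simp: pair_invertible_def bij_betw_def)
  then show ?thesis using that by auto
qed

text \<open>Conjugating the pair map by \<open>prod.swap\<close> exchanges the two operations. This
  passes from under-crossings to over-crossings.\<close>

lemma swap: "switch A v u"
proof
  have "bij_betw prod.swap (A \<times> A) (A \<times> A)"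
    by (auto intro!: bij_betwI[where g = prod.swap])
  then have "bij_betw (prod.swap \<circ> (\<lambda>(x, y). (v y x, u x y)) \<circ> prod.swap) (A \<times> A) (A \<times> A)"
    using pair unfolding pair_invertible_def by (meson bij_betw_trans)
  moreover have "prod.swap \<circ> (\<lambda>(x, y). (v y x, u x y)) \<circ> prod.swap = (\<lambda>(x, y). (u y x, v x y))"
    by auto
  ultimately show "pair_invertible A v u"
    by (simp add: pair_invertible_def)
qed (use closed rinv in auto)

end

locale diagonal_switch = switch +
  assumes finite: "finite A" and diag: "x \<in> A \<Longrightarrow> u x x = v x x"
begin

text \<open>On the diagonal both components of the pair map are the square, so injectivity of the
  pair map suffices.\<close>

lemma square_cancel:
  assumes "x \<in> A" "y \<in> A" "u x x = u y y" shows "x = y"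
  using pair_cancel[of x x y y] assms diag by metis

lemma square_solve: assumes "x \<in> A" obtains y where "y \<in> A" "u y y = x"
proof -
  have "inj_on (\<lambda>y. u y y) A" by (rule inj_onI) (rule square_cancel)
  then have "(\<lambda>y. u y y) ` A = A"
    by (intro endo_inj_surj[OF finite]) auto
  then have "x \<in> (\<lambda>y. u y y) ` A" using assms by simp
  then show ?thesis using that by auto
qed

text \<open>A loop joining the two right ends forces \<open>u x z = v z x\<close>. Once this common
  label is written as a square \<open>u w w\<close>, the pairs \<open>(x, z)\<close> and
  \<open>(w, w)\<close> have the same image under the pair map.\<close>

lemma loop_right_iff:
  assumes "x \<in> A"
  shows "(\<exists>y\<in>A. z \<in> A \<and> side_rel u v x y z y) \<longleftrightarrow> z = x"
proof
  assume "\<exists>y\<in>A. z \<in> A \<and> side_rel u v x y z y"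
  then obtain y where y: "y \<in> A" "z \<in> A" "side_rel u v x y z y" by blast
  obtain w where w: "w \<in> A" "u w w = y" using square_solve y(1) by metis
  have "v z x = v w w" "u x z = u w w"
    using assms w y diag by (auto simp: side_rel_def)
  then show "z = x" using pair_cancel[of x z w w] w assms y by auto
next
  assume "z = x"
  then show "\<exists>y\<in>A. z \<in> A \<and> side_rel u v x y z y"
    using assms diag by (auto simp: side_rel_def)
qed

text \<open>With a loop joining the two left ends, both outer labels are the square of the loop
  label; a loop label exists because squaring is surjective.\<close>

lemma loop_left_iff:
  assumes "x \<in> A"
  shows "(\<exists>y\<in>A. side_rel u v y x y z) \<longleftrightarrow> z = x"
proof
  assume "\<exists>y\<in>A. side_rel u v y x y z"
  then show "z = x" using diag by (auto simp: side_rel_def)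
next
  assume "z = x"
  obtain y where "y \<in> A" "u y y = x" using square_solve assms by metis
  with \<open>z = x\<close> show "\<exists>y\<in>A. side_rel u v y x y z"
    using diag by (auto simp: side_rel_def)
qed

lemma diagonal_switch_swap: "diagonal_switch A v u"
  using swap finite diag by (simp add: diagonal_switch_def diagonal_switch_axioms_def)

end

text \<open>\<open>T\<close> is the relation at a transverse double point; for colorings by a biquandle it is taken to
  be always true.\<close>

definition crossing_rel ::
  "('a, 'm) biq_scheme \<Rightarrow> ('a \<Rightarrow> 'a \<Rightarrow> 'a \<Rightarrow> 'a \<Rightarrow> bool) \<Rightarrow>
   kind \<Rightarrow> dir \<Rightarrow> dir \<Rightarrow> 'a \<Rightarrow> 'a \<Rightarrow> 'a \<Rightarrow> 'a \<Rightarrow> bool" where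
  "crossing_rel X T k a b sw se nw ne \<longleftrightarrow> {sw, se, nw, ne} \<subseteq> carrier X \<and>
     (case upright a b (sw, se, nw, ne) of (p, q, r, s) \<Rightarrow>
       (case k of
          Over \<Rightarrow> (if a = b then side_rel (otri X) (utri X) p q r s
                          else side_rel (utri X) (otri X) p q r s)
        | Under \<Rightarrow> (if a = b then side_rel (utri X) (otri X) p q r s
                          else side_rel (otri X) (utri X) p q r s)
        | Virtual \<Rightarrow> side_rel (\<lambda>x y. x) (\<lambda>x y. x) p q r s
        | _ \<Rightarrow> T p q r s))"

abbreviation "bul_rel X \<equiv> side_rel (ubul X) (obul X)"

lemma crossing_rel_carrier:
  assumes "crossing_rel X T k a b p q r s"
  shows "p \<in> carrier X" "q \<in> carrier X" "r \<in> carrier X" "s \<in> carrier X"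
  using assms by (auto simp: crossing_rel_def)

text \<open>A clockwise quarter turn moves the corners south-west, south-east, north-west,
  north-east to north-west, south-west, north-east, south-east, and the strand of direction
  \<open>a\<close> becomes the south-east to north-west strand, with reversed direction. Both sides
  have the same upright form.\<close>

lemma crossing_rel_rotate:
  "crossing_rel X T (flip k) b (opp a) p q r s \<longleftrightarrow> crossing_rel X T k a b r p s q"
  by (cases k; cases a; cases b) (auto simp: crossing_rel_def)

lemma opp_opp [simp]: "opp (opp a) = a"
  by (cases a) auto

lemma flip_flip [simp]: "flip (flip k) = k"
  by (cases k) auto

lemma crossing_rel_half_turn:
  "crossing_rel X T k (opp a) (opp b) s r q p \<longleftrightarrow> crossing_rel X T k a b p q r s"
  using crossing_rel_rotate[of X T "flip k" "opp a" b s r q p]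
    crossing_rel_rotate[of X T k b a q s p r]
  by (cases k; cases a; cases b) (auto simp: crossing_rel_def)

text \<open>Reflecting a crossing in a horizontal line and reversing both strands preserves left and
  right ends of each strand as well as over and under. The bullet operations are excluded because
  the reflection would exchange them.\<close>

lemma crossing_rel_upside_down:
  "k \<in> {Over, Under, Virtual} \<Longrightarrow>
    crossing_rel X T (flip k) b a m n p q \<longleftrightarrow> crossing_rel X T k a b p q m n"
  by (cases k; cases a; cases b) (auto simp: crossing_rel_def side_rel_def)

definition determined :: "'a set \<Rightarrow> ('a \<Rightarrow> 'a \<Rightarrow> 'a \<Rightarrow> 'a \<Rightarrow> bool) \<Rightarrow> bool" where
  "determined A R \<longleftrightarrow> (\<forall>p\<in>A. \<forall>q\<in>A.
     (\<exists>r s. R p q r s) \<and> (\<forall>r s r' s'. R p q r s \<longrightarrow> R p q r' s' \<longrightarrow> r = r' \<and> s = s'))"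

lemma determined_exists:
  "\<lbrakk>determined A R; p \<in> A; q \<in> A\<rbrakk> \<Longrightarrow> \<exists>r s. R p q r s"
  unfolding determined_def by blast

lemma determined_unique:
  "\<lbrakk>determined A R; R p q r s; R p q r' s'; p \<in> A; q \<in> A\<rbrakk> \<Longrightarrow> r = r' \<and> s = s'"
  unfolding determined_def by blast

text \<open>Reading a crossing from bottom to top uses a different part of the axioms for each
  orientation: right-invertibility of \<open>v\<close> for two upward strands, of \<open>u\<close>
  for two downward ones, the pair map for \<open>Up Down\<close>, and mere evaluation for
  \<open>Down Up\<close>.\<close>

lemma (in switch) determined_side_rel:
  "determined A (\<lambda>sw se nw ne. {sw, se, nw, ne} \<subseteq> A \<and>
     (case upright a b (sw, se, nw, ne) of (p, q, r, s) \<Rightarrow> side_rel u v p q r s))"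
    (is "determined A ?R")
  unfolding determined_def
proof (intro allI ballI conjI)
  fix p q assume pq: "p \<in> A" "q \<in> A"
  show "\<exists>r s. ?R p q r s"
  proof (cases a; cases b)
    assume "a = Up" "b = Up"
    then show ?thesis using pq v_solve[OF pq(2,1)] by (simp add: side_rel_def) (metis closed_u)
  next
    assume "a = Up" "b = Down"
    then show ?thesis using pq pair_solve[OF pq] by (simp add: side_rel_def) metis
  next
    assume "a = Down" "b = Up"
    then show ?thesis using pq by (simp add: side_rel_def)
  next
    assume "a = Down" "b = Down"
    then show ?thesis using pq u_solve[OF pq] by (simp add: side_rel_def) (metis closed_v)
  qed
  fix r s r' s'
  show "?R p q r s \<longrightarrow> ?R p q r' s' \<longrightarrow> r = r' \<and> s = s'"
    using v_cancel[of r r' p] u_cancel[of s s' q] pair_cancel[of r s r' s']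
    by (cases a; cases b) (auto simp: side_rel_def)
qed

lemma switch_trivial: "switch A (\<lambda>x y. x) (\<lambda>x y. x)"
  by standard (auto simp: binop_on_def right_invertible_def pair_invertible_def
      intro!: exI[of _ "\<lambda>x y. x"] bij_betwI[where g = prod.swap])

lemma (in biquandle) tri_switch: "switch (carrier X) (utri X) (otri X)"
  using tri_closed tri_right_invertible tri_pair_invertible by (simp add: switch_def)

lemma determined_virtual: "determined (carrier X) (crossing_rel X T Virtual a b)"
  using switch.determined_side_rel[OF switch_trivial, of "carrier X" a b]
  unfolding crossing_rel_def by simp

lemma (in biquandle) determined_classical:
  assumes "k \<in> {Over, Under}" shows "determined (carrier X) (crossing_rel X T k a b)"
  using assms switch.determined_side_rel[OF tri_switch, of a b]
    switch.determined_side_rel[OF switch.swap[OF tri_switch], of a b]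
  unfolding crossing_rel_def by (cases "a = b") auto

lemma (in psyquandle) bul_switch: "switch (carrier X) (ubul X) (obul X)"
  using bul_closed bul_right_invertible bul_pair_invertible by (simp add: switch_def)

lemma (in psyquandle) determined_bul:
  assumes "k \<in> {Singular, Precrossing}"
  shows "determined (carrier X) (crossing_rel X (bul_rel X) k a b)"
  using assms switch.determined_side_rel[OF bul_switch, of a b]
  unfolding crossing_rel_def by auto

section \<open>Boundary relations of the triangle moves\<close>

definition yang_baxter ::
  "(kind \<Rightarrow> dir \<Rightarrow> dir \<Rightarrow> 'a \<Rightarrow> 'a \<Rightarrow> 'a \<Rightarrow> 'a \<Rightarrow> bool) \<Rightarrow>
   kind \<Rightarrow> kind \<Rightarrow> kind \<Rightarrow> dir \<Rightarrow> dir \<Rightarrow> dir \<Rightarrow> bool" where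
  "yang_baxter Q k12 k13 k23 a b c \<longleftrightarrow> (\<forall>x1 x2 x3 z1 z2 z3.
     (\<exists>y1 y2 y3. Q k12 a b x1 x2 y2 y1 \<and> Q k13 a c y1 x3 y3 z1 \<and> Q k23 b c y2 y3 z3 z2) \<longleftrightarrow>
     (\<exists>y1 y2 y3. Q k23 b c x2 x3 y3 y2 \<and> Q k13 a c x1 y3 z3 y1 \<and> Q k12 a b y1 y2 z2 z1))"

text \<open>Counterclockwise, the boundary points form the hexagon \<open>x1\<close>,
  \<open>x2\<close>, \<open>x3\<close>, \<open>z1\<close>, \<open>z2\<close>, \<open>z3\<close>.
  Turning it by one step makes strands 2, 3 and the reversed strand 1 the new strands 1, 2, 3 and
  exchanges the two sides of the move.\<close>

lemma yang_baxter_rotate: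
  "yang_baxter (crossing_rel X T) k23 (flip k12) (flip k13) b c (opp a) \<longleftrightarrow>
   yang_baxter (crossing_rel X T) k12 k13 k23 a b c"
proof -
  let ?Q = "crossing_rel X T"
  have "(\<exists>y1 y2 y3. ?Q k23 b c x2 x3 y2 y1 \<and> ?Q (flip k12) b (opp a) y1 z1 y3 z2 \<and>
        ?Q (flip k13) c (opp a) y2 y3 x1 z3) \<longleftrightarrow>
      (\<exists>y1 y2 y3. ?Q k23 b c x2 x3 y3 y2 \<and> ?Q k13 a c x1 y3 z3 y1 \<and> ?Q k12 a b y1 y2 z2 z1)"
    and "(\<exists>y1 y2 y3. ?Q (flip k13) c (opp a) x3 z1 y3 y2 \<and> ?Q (flip k12) b (opp a) x2 y3 x1 y1 \<and>
        ?Q k23 b c y1 y2 z3 z2) \<longleftrightarrow>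
      (\<exists>y1 y2 y3. ?Q k12 a b x1 x2 y2 y1 \<and> ?Q k13 a c y1 x3 y3 z1 \<and> ?Q k23 b c y2 y3 z3 z2)"
    for x1 x2 x3 z1 z2 z3
    unfolding crossing_rel_rotate by blast+
  then show ?thesis unfolding yang_baxter_def by (intro iffI allI; simp)
qed

text \<open>Each side is the graph of a total function from the bottom labels to the top labels, and
  a graph of this sort contained in another one equals it.\<close>

lemma yang_baxterI:
  assumes det: "\<And>k a b. k \<in> {k12, k13, k23} \<Longrightarrow> determined (carrier X) (crossing_rel X T k a b)"
    and imp: "\<And>x1 x2 x3 z1 z2 z3 y1 y2 y3.
      \<lbrakk>crossing_rel X T k12 a b x1 x2 y2 y1; crossing_rel X T k13 a c y1 x3 y3 z1;
       crossing_rel X T k23 b c y2 y3 z3 z2\<rbrakk> \<Longrightarrow>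
      \<exists>y1 y2 y3. crossing_rel X T k23 b c x2 x3 y3 y2 \<and> crossing_rel X T k13 a c x1 y3 z3 y1 \<and>
        crossing_rel X T k12 a b y1 y2 z2 z1"
  shows "yang_baxter (crossing_rel X T) k12 k13 k23 a b c"
  unfolding yang_baxter_def
proof (intro allI iffI; elim exE conjE)
  let ?Q = "crossing_rel X T"
  have ex: "\<exists>r s. ?Q k a b p q r s"
    if "k \<in> {k12, k13, k23}" "p \<in> carrier X" "q \<in> carrier X" for k a b p q
    using det[OF that(1)] that(2,3) unfolding determined_def by blast
  have un: "r = r' \<and> s = s'"
    if "k \<in> {k12, k13, k23}" "?Q k a b p q r s" "?Q k a b p q r' s'" for k a b p q r s r' s'
    using det[OF that(1)] that(2,3) crossing_rel_carrier[OF that(2)]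
    unfolding determined_def by blast
  fix x1 x2 x3 z1 z2 z3 w1 w2 w3
  assume R: "?Q k23 b c x2 x3 w3 w2" "?Q k13 a c x1 w3 z3 w1" "?Q k12 a b w1 w2 z2 z1"
  note C = crossing_rel_carrier
  obtain y1 y2 where y12: "?Q k12 a b x1 x2 y2 y1"
    using ex[of k12 x1 x2 a b] C(1)[OF R(2)] C(1)[OF R(1)] by auto
  obtain y3 z1' where y3: "?Q k13 a c y1 x3 y3 z1'"
    using ex[of k13 y1 x3 a c] C(2)[OF R(1)] C(4)[OF y12] by auto
  obtain z2' z3' where z23: "?Q k23 b c y2 y3 z3' z2'"
    using ex[of k23 y2 y3 b c] C(3)[OF y3] C(3)[OF y12] by auto
  obtain v1 v2 v3 where v: "?Q k23 b c x2 x3 v3 v2" "?Q k13 a c x1 v3 z3' v1" "?Q k12 a b v1 v2 z2' z1'"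
    using imp[OF y12 y3 z23] by blast
  have v32: "v3 = w3 \<and> v2 = w2" using un[OF _ v(1) R(1)] by simp
  then have v31: "z3' = z3 \<and> v1 = w1" using un[of k13, OF _ _ R(2), of z3' v1] v(2) by simp
  with v32 have "z2' = z2 \<and> z1' = z1" using un[of k12, OF _ _ R(3), of z2' z1'] v(3) by simp
  with v31 y12 y3 z23
  show "\<exists>y1 y2 y3. ?Q k12 a b x1 x2 y2 y1 \<and> ?Q k13 a c y1 x3 y3 z1 \<and> ?Q k23 b c y2 y3 z3 z2"
    by blast
qed (use imp in blast)

text \<open>The three triples are those of \<open>slide\<close>, for the sliding strand in position
  1, 2 or 3. A \<open>flip\<close> occurs where the sliding strand is the south-east to north-west
  strand of the crossing.\<close>

definition slide_kinds :: "kind \<Rightarrow> kind \<Rightarrow> kind \<Rightarrow> kind \<Rightarrow> kind \<Rightarrow> bool" where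
  "slide_kinds u x k12 k13 k23 \<longleftrightarrow>
     (k12, k13, k23) \<in> {(u, u, x), (flip u, x, u), (x, flip u, flip u)}"

text \<open>A rotation permutes the triples of \<open>slide_kinds u\<close>, but when the sliding
  strand is number 2 or 3 it replaces \<open>x\<close> by \<open>flip x\<close>. Hence the claim is
  made for all \<open>x\<close> in a set closed under \<open>flip\<close> at once.\<close>

lemma yang_baxter_reorient:
  assumes fl: "\<And>x. x \<in> K \<Longrightarrow> flip x \<in> K"
    and base: "\<And>x k12 k13 k23. x \<in> K \<Longrightarrow> slide_kinds u x k12 k13 k23 \<Longrightarrow>
      yang_baxter (crossing_rel X T) k12 k13 k23 Up Up Up \<and>
      yang_baxter (crossing_rel X T) k12 k13 k23 Up Down Up"
    and "x \<in> K" "slide_kinds u x k12 k13 k23"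
  shows "yang_baxter (crossing_rel X T) k12 k13 k23 a b c"
proof -
  let ?P = "\<lambda>a b c. \<forall>x k12 k13 k23. x \<in> K \<longrightarrow> slide_kinds u x k12 k13 k23 \<longrightarrow>
    yang_baxter (crossing_rel X T) k12 k13 k23 a b c"
  have rot: "?P a b c" if "?P b c (opp a)" for a b c
  proof (intro allI impI)
    fix x k12 k13 k23 assume x: "x \<in> K" "slide_kinds u x k12 k13 k23"
    then have "slide_kinds u x k23 (flip k12) (flip k13) \<or>
        slide_kinds u (flip x) k23 (flip k12) (flip k13)"
      by (auto simp: slide_kinds_def)
    with that x fl show "yang_baxter (crossing_rel X T) k12 k13 k23 a b c"
      using yang_baxter_rotate by blast
  qed
  \<comment> \<open>The map taking \<open>(a, b, c)\<close> to \<open>(b, c, opp a)\<close> has two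
    orbits: six orientations around \<open>Up Up Up\<close>, and \<open>Up Down Up\<close> together
    with \<open>Down Up Down\<close>.\<close>
  have UUU: "?P Up Up Up" and UDU: "?P Up Down Up" using base by auto
  have DUU: "?P Down Up Up" by (rule rot) (use UUU in simp)
  have DDU: "?P Down Down Up" by (rule rot) (use DUU in simp)
  have DDD: "?P Down Down Down" by (rule rot) (use DDU in simp)
  have UDD: "?P Up Down Down" by (rule rot) (use DDD in simp)
  have UUD: "?P Up Up Down" by (rule rot) (use UDD in simp)
  have DUD: "?P Down Up Down" by (rule rot) (use UDU in simp)
  show ?thesis using UUU UDU DUU DDU DDD UDD UUD DUD assms(3,4) by (cases a; cases b; cases c) simp_all
qed

text \<open>Labels pass unchanged through virtual crossings, so either side reduces to the one
  crossing of kind \<open>x\<close> next to a strand with constant label.\<close>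

lemma yang_baxter_virtual:
  assumes "slide_kinds Virtual x k12 k13 k23"
  shows "yang_baxter (crossing_rel X T) k12 k13 k23 a b c"
proof -
  have V: "crossing_rel X T Virtual a b p q r s \<longleftrightarrow> {p, q} \<subseteq> carrier X \<and> r = q \<and> s = p" for a b p q r s
    by (cases a; cases b) (auto simp: crossing_rel_def side_rel_def)
  show ?thesis
    using assms by (auto simp: slide_kinds_def yang_baxter_def V dest: crossing_rel_carrier)
qed

context biquandle
begin

lemma tri_carrier [simp]:
  "x \<in> carrier X \<Longrightarrow> y \<in> carrier X \<Longrightarrow> x \<rhd>\<^sub>u y \<in> carrier X"
  "x \<in> carrier X \<Longrightarrow> y \<in> carrier X \<Longrightarrow> x \<rhd>\<^sub>o y \<in> carrier X"
  using tri_closed by (auto simp: binop_on_def)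

text \<open>On the first side every label is a value of the operations at three free ones:
  \<open>x1\<close>, \<open>y2\<close>, \<open>z3\<close> if \<open>b = Up\<close>, and
  \<open>y1\<close>, \<open>y2\<close>, \<open>y3\<close> if \<open>b = Down\<close>. After
  substitution the equations of the second side are exchange laws, some of them read
  backwards.\<close>

lemma yang_baxter_classical_base:
  assumes "(k12, k13, k23) \<in> {(Over, Over, Over), (Under, Under, Under), (Over, Over, Under),
    (Under, Under, Over), (Under, Over, Over), (Over, Under, Under)}"
  shows "yang_baxter (crossing_rel X T) k12 k13 k23 Up b Up"
proof (rule yang_baxterI)
  show "determined (carrier X) (crossing_rel X T k a b)" if "k \<in> {k12, k13, k23}" for k a b
    using that assms determined_classical by blast
  let ?imp = "\<lambda>k12 k13 k23 b. \<forall>x1 x2 x3 z1 z2 z3 y1 y2 y3.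
    crossing_rel X T k12 Up b x1 x2 y2 y1 \<longrightarrow> crossing_rel X T k13 Up Up y1 x3 y3 z1 \<longrightarrow>
    crossing_rel X T k23 b Up y2 y3 z3 z2 \<longrightarrow>
    (\<exists>y1 y2 y3. crossing_rel X T k23 b Up x2 x3 y3 y2 \<and> crossing_rel X T k13 Up Up x1 y3 z3 y1 \<and>
        crossing_rel X T k12 Up b y1 y2 z2 z1)"
  have "?imp Over Over Over Up" "?imp Over Over Over Down" "?imp Under Under Under Up"
      "?imp Under Under Under Down" "?imp Over Over Under Up" "?imp Over Over Under Down"
      "?imp Under Under Over Up" "?imp Under Under Over Down" "?imp Under Over Over Up"
      "?imp Under Over Over Down" "?imp Over Under Under Up" "?imp Over Under Under Down"
    by (auto simp: crossing_rel_def side_rel_def intro: exchange exchange[symmetric])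
  then have "?imp k12 k13 k23 b"
    using assms by (cases b; elim insertE emptyE Pair_inject; simp only:)
  then show "\<exists>y1 y2 y3. crossing_rel X T k23 b Up x2 x3 y3 y2 \<and> crossing_rel X T k13 Up Up x1 y3 z3 y1 \<and>
        crossing_rel X T k12 Up b y1 y2 z2 z1"
    if "crossing_rel X T k12 Up b x1 x2 y2 y1" "crossing_rel X T k13 Up Up y1 x3 y3 z1"
       "crossing_rel X T k23 b Up y2 y3 z3 z2" for x1 x2 x3 z1 z2 z3 y1 y2 y3
    using that by blast
qed

lemma yang_baxter_classical:
  assumes "u \<in> {Over, Under}" "x \<in> {Over, Under}" "slide_kinds u x k12 k13 k23"
  shows "yang_baxter (crossing_rel X T) k12 k13 k23 a b c"
proof (rule yang_baxter_reorient[where K = "{Over, Under}", OF _ _ assms(2,3)])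
  fix x k12 k13 k23 assume x: "x \<in> {Over, Under}" "slide_kinds u x k12 k13 k23"
  have "(k12, k13, k23) \<in> {(Over, Over, Over), (Under, Under, Under), (Over, Over, Under),
      (Under, Under, Over), (Under, Over, Over), (Over, Under, Under)}"
    using x(2) unfolding slide_kinds_def
    by (rule insertE; use assms(1) x(1) in \<open>elim insertE emptyE; simp\<close>)
  then show "yang_baxter (crossing_rel X T) k12 k13 k23 Up Up Up \<and>
      yang_baxter (crossing_rel X T) k12 k13 k23 Up Down Up"
    by (intro conjI yang_baxter_classical_base)
qed auto

end

context psyquandle
begin

lemma bul_carrier [simp]:
  "x \<in> carrier X \<Longrightarrow> y \<in> carrier X \<Longrightarrow> x \<bullet>\<^sub>u y \<in> carrier X"
  "x \<in> carrier X \<Longrightarrow> y \<in> carrier X \<Longrightarrow> x \<bullet>\<^sub>o y \<in> carrier X"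
  using bul_closed by (auto simp: binop_on_def)

text \<open>The free labels are the same as in the classical case, and the remaining equations are
  instances of the six laws of \<open>mixed_exchange\<close>. Both kinds of double point are fixed
  by \<open>flip\<close>, so the set of kinds is closed as required.\<close>

lemma yang_baxter_bul:
  assumes "u \<in> {Over, Under}" "x \<in> {Singular, Precrossing}" "slide_kinds u x k12 k13 k23"
  shows "yang_baxter (crossing_rel X (bul_rel X)) k12 k13 k23 a b c"
proof (rule yang_baxter_reorient[where K = "{Singular, Precrossing}", OF _ _ assms(2,3)])
  fix x k12 k13 k23 assume k: "x \<in> {Singular, Precrossing}" "slide_kinds u x k12 k13 k23"
  have det: "determined (carrier X) (crossing_rel X (bul_rel X) k a b)" if "k \<in> {k12, k13, k23}" for k a b
    using that k assms(1) determined_classical determined_bul by (auto simp: slide_kinds_def)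
  show "yang_baxter (crossing_rel X (bul_rel X)) k12 k13 k23 Up Up Up \<and>
      yang_baxter (crossing_rel X (bul_rel X)) k12 k13 k23 Up Down Up"
    by (intro conjI yang_baxterI det; (use k assms(1) in \<open>auto simp: slide_kinds_def crossing_rel_def side_rel_def mixed_exchange\<close>)?)
qed auto

end

section \<open>Exchanging a double point and a classical crossing\<close>

definition commute ::
  "(kind \<Rightarrow> dir \<Rightarrow> dir \<Rightarrow> 'a \<Rightarrow> 'a \<Rightarrow> 'a \<Rightarrow> 'a \<Rightarrow> bool) \<Rightarrow> kind \<Rightarrow> kind \<Rightarrow> dir \<Rightarrow> dir \<Rightarrow> bool" where
  "commute Q j k a b \<longleftrightarrow> (\<forall>p q r s.
     (\<exists>m n. Q j a b p q m n \<and> Q k b a m n r s) \<longleftrightarrow> (\<exists>m n. Q k a b p q m n \<and> Q j b a m n r s))"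

lemma commute_sym: "commute Q j k a b \<longleftrightarrow> commute Q k j a b"
  unfolding commute_def by blast

lemma commuteI:
  assumes det: "\<And>a b. determined (carrier X) (crossing_rel X T j a b)"
      "\<And>a b. determined (carrier X) (crossing_rel X T k a b)"
    and imp: "\<And>p q m n r s. \<lbrakk>crossing_rel X T j a b p q m n; crossing_rel X T k b a m n r s\<rbrakk> \<Longrightarrow>
      \<exists>m n. crossing_rel X T k a b p q m n \<and> crossing_rel X T j b a m n r s"
  shows "commute (crossing_rel X T) j k a b"
  unfolding commute_def
proof (intro allI iffI; elim exE conjE)
  let ?Q = "crossing_rel X T"
  fix p q r s m n assume R: "?Q k a b p q m n" "?Q j b a m n r s"
  note C = crossing_rel_carrier
  obtain m1 n1 where 1: "?Q j a b p q m1 n1"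
    using determined_exists[OF det(1)[of a b], of p q] C(1,2)[OF R(1)] by auto
  obtain r1 s1 where 2: "?Q k b a m1 n1 r1 s1"
    using determined_exists[OF det(2)[of b a], of m1 n1] C(3,4)[OF 1] by auto
  obtain m2 n2 where 3: "?Q k a b p q m2 n2" "?Q j b a m2 n2 r1 s1"
    using imp[OF 1 2] by blast
  have "m2 = m \<and> n2 = n"
    using determined_unique[OF det(2) 3(1) R(1)] C(1,2)[OF R(1)] by simp
  then have "r1 = r \<and> s1 = s"
    using determined_unique[OF det(1) 3(2), of r s] R(2) C(1,2)[OF R(2)] by simp
  then show "\<exists>m n. ?Q j a b p q m n \<and> ?Q k b a m n r s"
    using 1 2 by blast
qed (use imp in blast)

text \<open>Reading \<open>k a b\<close> upside down gives \<open>flip k b a\<close>, so the two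
  relations are inverse to each other. Composing the given identity with inverses on both sides
  yields the new one, with the two directions exchanged.\<close>

lemma commute_flip:
  assumes k: "k \<in> {Over, Under}"
    and det: "\<And>k a b. k \<in> {Over, Under} \<Longrightarrow> determined (carrier X) (crossing_rel X T k a b)"
    and com: "commute (crossing_rel X T) j k a b"
  shows "commute (crossing_rel X T) j (flip k) b a"
  unfolding commute_def
proof (intro allI iffI; elim exE conjE)
  let ?Q = "crossing_rel X T"
  have k': "k \<in> {Over, Under, Virtual}" "flip k \<in> {Over, Under}" using k by auto
  note ud = crossing_rel_upside_down[OF k'(1)]
  note C = crossing_rel_carrier
  fix p q r s m n
  {
    assume R: "?Q j b a p q m n" "?Q (flip k) a b m n r s"
    obtain x y where xy: "?Q (flip k) b a p q x y"
      using determined_exists[OF det[OF k'(2)], of p q b a] C(1,2)[OF R(1)] by auto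
    then have "?Q k a b x y p q" by (simp add: ud)
    then obtain r' s' where rs: "?Q j a b x y r' s'" "?Q k b a r' s' m n"
      using com R(1) unfolding commute_def by blast
    then have "?Q (flip k) a b m n r' s'" by (simp add: ud)
    then have "r' = r \<and> s' = s"
      using determined_unique[OF det[OF k'(2)] _ R(2)] C(1,2)[OF R(2)] by blast
    with xy rs show "\<exists>m n. ?Q (flip k) b a p q m n \<and> ?Q j a b m n r s" by blast
  next
    assume R: "?Q (flip k) b a p q m n" "?Q j a b m n r s"
    obtain x y where xy: "?Q k b a r s x y"
      using determined_exists[OF det[OF k], of r s b a] C(3,4)[OF R(2)] by auto
    then obtain p' q' where pq: "?Q k a b m n p' q'" "?Q j b a p' q' x y"
      using com R(2) unfolding commute_def by blast
    have "?Q k a b m n p q" using R(1) by (simp add: ud)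
    then have "p' = p \<and> q' = q"
      using determined_unique[OF det[OF k] pq(1)] C(1,2)[OF pq(1)] by blast
    with pq xy show "\<exists>m n. ?Q j b a p q m n \<and> ?Q (flip k) a b m n r s"
      by (auto simp: ud)
  }
qed

text \<open>A half turn exchanges bottom and top, hence the two sides of the swap. It takes
  \<open>Up Up\<close> to \<open>Down Down\<close> but fixes \<open>Up Down\<close> and
  \<open>Down Up\<close>.\<close>

lemma commute_half_turn:
  "commute (crossing_rel X T) j k (opp b) (opp a) \<longleftrightarrow> commute (crossing_rel X T) j k a b"
proof -
  let ?Q = "crossing_rel X T"
  have *: "(\<exists>m n. ?Q j (opp b) (opp a) p q m n \<and> ?Q k (opp a) (opp b) m n r s) \<longleftrightarrow>
      (\<exists>m n. ?Q k a b s r m n \<and> ?Q j b a m n q p)" for j k p q r s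
    unfolding crossing_rel_half_turn by blast
  show ?thesis unfolding commute_def * by blast
qed

lemma rinv_eqI:
  assumes "right_invertible A f" "z \<in> A" "y \<in> A" "f z y = x"
  shows "rinv A f x y = z"
proof -
  have "inj_on (\<lambda>z. f z y) A"
    using assms(1,3) unfolding right_invertible_def by (auto intro!: inj_onI) metis
  then show ?thesis using assms unfolding rinv_def by (metis inv_into_f_f)
qed

section \<open>Swaps of parallel strands\<close>

context psyquandle
begin

text \<open>Axiom (iv) without division: \<open>s\<close> and \<open>m\<close> name the two
  quotients by the overlined bullet operation.\<close>

lemma tri_bul_exchange:
  assumes "x \<in> carrier X" "y \<in> carrier X" "m \<in> carrier X" "s \<in> carrier X"
    and "y \<rhd>\<^sub>o x = s \<bullet>\<^sub>o x" "x \<rhd>\<^sub>u y = m \<bullet>\<^sub>o y"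
  shows "x \<bullet>\<^sub>u s = m \<rhd>\<^sub>o s" "y \<bullet>\<^sub>u m = s \<rhd>\<^sub>u m"
proof -
  have "(y \<rhd>\<^sub>o x) \<bullet>\<^sub>o\<inverse> x = s" "(x \<rhd>\<^sub>u y) \<bullet>\<^sub>o\<inverse> y = m"
    using assms by (auto intro!: rinv_eqI bul_right_invertible)
  then show "x \<bullet>\<^sub>u s = m \<rhd>\<^sub>o s" "y \<bullet>\<^sub>u m = s \<rhd>\<^sub>u m"
    using bul_tri_swap[of x y] assms by simp_all
qed

lemma commute_Up_Up:
  assumes s: "s \<in> {Singular, Precrossing}" and k: "k \<in> {Over, Under}"
  shows "commute (crossing_rel X (bul_rel X)) s k Up Up"
proof -
  let ?Q = "crossing_rel X (bul_rel X)"
  interpret b: switch "carrier X" "ubul X" "obul X" by (rule bul_switch)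
  have Over: "commute ?Q Over s Up Up"
  proof (rule commuteI)
    fix p q m n r t assume "?Q Over Up Up p q m n" "?Q s Up Up m n r t"
    then have C: "p \<in> carrier X" "q \<in> carrier X" "m \<in> carrier X" "r \<in> carrier X" "t \<in> carrier X"
      and eq: "q = m \<rhd>\<^sub>u p" "p \<rhd>\<^sub>o m = r \<bullet>\<^sub>o m" "t = m \<bullet>\<^sub>u r"
      using s by (auto simp: crossing_rel_def side_rel_def)
    \<comment> \<open>After the swap the double point lies below, with left labels \<open>p\<close>
      and \<open>z\<close>. Its bottom right label must still be \<open>q\<close>, which defines
      \<open>z\<close> as a quotient.\<close>
    obtain z where z: "z \<in> carrier X" "m \<rhd>\<^sub>u p = z \<bullet>\<^sub>o p"
      using b.v_solve C eq by metis
    show "\<exists>m n. ?Q s Up Up p q m n \<and> ?Q Over Up Up m n r t"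
      using tri_bul_exchange[OF C(3,1) z(1) C(4) eq(2) z(2)] z eq C s
      by (intro exI[of _ z] exI[of _ "p \<bullet>\<^sub>u z"]) (auto simp: crossing_rel_def side_rel_def)
  qed (use s in \<open>auto intro: determined_classical determined_bul\<close>)
  from this[unfolded commute_sym[of _ _ s]]
    commute_flip[OF _ _ this[unfolded commute_sym[of _ _ s]]]
  show ?thesis using k determined_classical by auto
qed

end

section \<open>Finite carriers and swaps of antiparallel strands\<close>

locale finite_biquandle = biquandle +
  assumes finite_carrier: "finite (carrier X)"

sublocale finite_biquandle \<subseteq> tri: diagonal_switch "carrier X" "utri X" "otri X"
  by (rule diagonal_switch.intro[OF tri_switch]) (simp add: diagonal_switch_axioms_def finite_carrier tri_diag)

locale finite_psyquandle = psyquandle X + finite_biquandle X for X :: "('a, 'm) psyq_scheme" (structure)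

context finite_psyquandle
begin

text \<open>The antiparallel swaps follow from the parallel ones by a planar argument, of which the next two
  lemmas are the algebraic form: move one of the twisted strands all the way around the vertex,
  which costs a kink and two slides; this leaves a parallel twist, which is swapped; then undo the
  kink with another strand. The kinks are the squares below.\<close>

lemma twist_in_out:
  assumes C: "m \<in> carrier X" "n \<in> carrier X"
    and "p = n \<bullet>\<^sub>o m" "q = m \<bullet>\<^sub>u n" "r = n \<rhd>\<^sub>u m" "s = m \<rhd>\<^sub>o n"
  shows "\<exists>m'\<in>carrier X. \<exists>n'\<in>carrier X. p = n' \<rhd>\<^sub>o m' \<and> q = m' \<rhd>\<^sub>u n' \<and> r = n' \<bullet>\<^sub>u m' \<and> s = m' \<bullet>\<^sub>o n'"
proof -
  let ?Q = "crossing_rel X (bul_rel X)"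
  \<comment> \<open>\<open>A\<close> is the label that a kink puts on the strand labelled
    \<open>m\<close>. The three equations below are slides across the vertex, that is, mixed
    exchange laws with \<open>m\<close> repeated.\<close>
  define A where "A = m \<rhd>\<^sub>u m"
  have D: "p \<in> carrier X" "q \<in> carrier X" "r \<in> carrier X" "s \<in> carrier X" "A \<in> carrier X"
    using C assms(3-) by (auto simp: A_def)
  have A': "A = m \<rhd>\<^sub>o m" using C tri_diag by (simp add: A_def)
  have 1: "q \<rhd>\<^sub>u s = A \<bullet>\<^sub>u r" using mixed_exchange(4)[of m m n] C assms(3-) by (simp add: A_def)
  have 2: "p \<rhd>\<^sub>u A = r \<bullet>\<^sub>o A" using mixed_exchange(6)[of n m m] C assms(3-) A' by (simp add: A_def)
  have 3: "s \<rhd>\<^sub>o q = A \<rhd>\<^sub>o p" using mixed_exchange(1)[of m m n] C assms(3-) A' by simp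
  \<comment> \<open>In terms of \<open>A\<close> the antiparallel configuration reads as a parallel
    one, a classical crossing followed by a double point, to which the parallel swap
    applies.\<close>
  have "?Q Under Up Up p (s \<rhd>\<^sub>o q) A (p \<rhd>\<^sub>u A)" "?Q Singular Up Up A (p \<rhd>\<^sub>u A) r (q \<rhd>\<^sub>u s)"
    using 1 2 3 D by (auto simp: crossing_rel_def side_rel_def)
  then obtain f g where "?Q Singular Up Up p (s \<rhd>\<^sub>o q) f g" "?Q Under Up Up f g r (q \<rhd>\<^sub>u s)"
    using commute_Up_Up[of Singular Under] unfolding commute_def by blast
  then have f: "f \<in> carrier X" "g = p \<bullet>\<^sub>u f" "s \<rhd>\<^sub>o q = f \<bullet>\<^sub>o p" "q \<rhd>\<^sub>u s = f \<rhd>\<^sub>u r" "g = r \<rhd>\<^sub>o f"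
    by (auto simp: crossing_rel_def side_rel_def)
  \<comment> \<open>The second kink is removed by taking a square root of the new inner label
    \<open>f\<close>; then \<open>n'\<close> is forced by the required equation for
    \<open>p\<close>.\<close>
  obtain m' where m': "m' \<in> carrier X" "m' \<rhd>\<^sub>u m' = f" using tri.square_solve f(1) by metis
  obtain n' where n': "n' \<in> carrier X" "n' \<rhd>\<^sub>o m' = p" using tri.v_solve D(1) m'(1) by metis
  have f': "f = m' \<rhd>\<^sub>o m'" using m' tri_diag by simp
  have "(n' \<bullet>\<^sub>u m') \<rhd>\<^sub>o f = r \<rhd>\<^sub>o f"
    using mixed_exchange(5)[of n' m' m'] m' n' f' f(2,5) by simp
  then have r: "r = n' \<bullet>\<^sub>u m'" using tri.v_cancel D f(1) m' n' by (metis bul_carrier(1))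
  have "(m' \<rhd>\<^sub>u n') \<rhd>\<^sub>u (m' \<bullet>\<^sub>o n') = q \<rhd>\<^sub>u s"
    using mixed_exchange(2)[of m' n' m'] m' n' r f(4) by simp
  moreover have "(m' \<bullet>\<^sub>o n') \<rhd>\<^sub>o (m' \<rhd>\<^sub>u n') = s \<rhd>\<^sub>o q"
    using mixed_exchange(3)[of m' m' n'] m' n' f' f(3) by simp
  \<comment> \<open>The last two wanted equations hold after applying the pair map to both sides,
    and the pair map is injective.\<close>
  ultimately have "m' \<rhd>\<^sub>u n' = q" "m' \<bullet>\<^sub>o n' = s"
    using tri.pair_cancel[of "m' \<rhd>\<^sub>u n'" "m' \<bullet>\<^sub>o n'" q s] m' n' D by simp_all
  then show ?thesis using r m' n' by metis
qed

lemma twist_out_in: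
  assumes C: "p \<in> carrier X" "q \<in> carrier X" "r \<in> carrier X" "s \<in> carrier X"
    and d: "p \<rhd>\<^sub>o q = r \<bullet>\<^sub>u s" and b: "q \<rhd>\<^sub>u p = s \<bullet>\<^sub>o r"
  shows "q \<bullet>\<^sub>u p = s \<rhd>\<^sub>o r" "p \<bullet>\<^sub>o q = r \<rhd>\<^sub>u s"
proof -
  let ?Q = "crossing_rel X (bul_rel X)"
  \<comment> \<open>Here the inner label of the given configuration is itself treated as a kink
    label, and \<open>e\<close> is its square root.\<close>
  obtain e where e: "e \<in> carrier X" "e \<rhd>\<^sub>u e = p \<rhd>\<^sub>o q" using tri.square_solve[of "p \<rhd>\<^sub>o q"] C by auto
  \<comment> \<open>\<open>x\<close> and \<open>y\<close> are the left labels of a classical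
    crossing with right labels \<open>e\<close> and \<open>s\<close>; the label \<open>i\<close>
    obtained next becomes \<open>r\<close> when it passes the strand labelled
    \<open>x\<close>.\<close>
  obtain y x where x: "x \<in> carrier X" "y \<in> carrier X" "x \<rhd>\<^sub>o y = e" "y \<rhd>\<^sub>u x = s"
    using tri.pair_solve[OF e(1) C(4)] by metis
  obtain i where i: "i \<in> carrier X" "i \<rhd>\<^sub>u x = r" using tri.u_solve[OF C(3) x(1)] by metis
  have "(i \<bullet>\<^sub>u y) \<rhd>\<^sub>u e = e \<rhd>\<^sub>u e"
    using mixed_exchange(4)[of i x y] i x e d by simp
  then have iy: "i \<bullet>\<^sub>u y = e" using tri.u_cancel[of "i \<bullet>\<^sub>u y" e e] e i x by simp
  have "(y \<bullet>\<^sub>o i) \<rhd>\<^sub>u (x \<rhd>\<^sub>o i) = q \<rhd>\<^sub>u p"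
    using mixed_exchange(6)[of y x i] i x b by simp
  moreover have "(x \<rhd>\<^sub>o i) \<rhd>\<^sub>o (y \<bullet>\<^sub>o i) = p \<rhd>\<^sub>o q"
    using mixed_exchange(1)[of x i y] i x iy e tri_diag[of e] by simp
  ultimately have pq: "y \<bullet>\<^sub>o i = q" "x \<rhd>\<^sub>o i = p"
    using tri.pair_cancel[of "y \<bullet>\<^sub>o i" "x \<rhd>\<^sub>o i" q p] i x C by simp_all
  \<comment> \<open>Again a parallel configuration, now with the double point below, and with
    \<open>e\<close> as inner label.\<close>
  have "?Q Singular Up Up i q y e" "?Q Under Up Up y e x s"
    using C e x i iy pq by (auto simp: crossing_rel_def side_rel_def)
  then obtain m n where "?Q Under Up Up i q m n" "?Q Singular Up Up m n x s"
    using commute_Up_Up[of Singular Under] unfolding commute_def by blast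
  then have m: "m \<in> carrier X" "n = i \<rhd>\<^sub>u m" "q = m \<rhd>\<^sub>o i" "s = m \<bullet>\<^sub>u x" "n = x \<bullet>\<^sub>o m"
    by (auto simp: crossing_rel_def side_rel_def)
  show "q \<bullet>\<^sub>u p = s \<rhd>\<^sub>o r" using mixed_exchange(5)[of m i x] m pq i x by simp
  \<comment> \<open>The second kink sits at \<open>n\<close>: the two squares of \<open>n\<close>
    agree, and this links the overlined expression to the underlined one.\<close>
  have "p \<bullet>\<^sub>o q = n \<rhd>\<^sub>o n" using mixed_exchange(3)[of x i m] m pq i x by simp
  also have "\<dots> = n \<rhd>\<^sub>u n" using tri_diag[of n] m i by simp
  also have "\<dots> = r \<rhd>\<^sub>u s" using mixed_exchange(2)[of i m x] m i x by simp
  finally show "p \<bullet>\<^sub>o q = r \<rhd>\<^sub>u s" .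
qed

lemma commute_bul:
  assumes s: "s \<in> {Singular, Precrossing}" and k: "k \<in> {Over, Under}"
  shows "commute (crossing_rel X (bul_rel X)) s k a b"
proof -
  let ?Q = "crossing_rel X (bul_rel X)"
  have det: "determined (carrier X) (?Q s a b)" "determined (carrier X) (?Q Over a b)" for a b
    using s determined_classical determined_bul by auto
  \<comment> \<open>\<open>commuteI\<close> needs one inclusion only: from the double point below to
    the classical crossing below, which is \<open>twist_in_out\<close>.\<close>
  have UD: "commute ?Q s Over Up Down"
  proof (rule commuteI[OF det])
    fix p q m n r t assume "?Q s Up Down p q m n" "?Q Over Down Up m n r t"
    then have *: "m \<in> carrier X" "n \<in> carrier X"
      "p = n \<bullet>\<^sub>o m" "q = m \<bullet>\<^sub>u n" "r = n \<rhd>\<^sub>u m" "t = m \<rhd>\<^sub>o n"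
      using s by (auto simp: crossing_rel_def side_rel_def)
    from twist_in_out[OF this] obtain m' n' where "m' \<in> carrier X" "n' \<in> carrier X"
      "p = n' \<rhd>\<^sub>o m'" "q = m' \<rhd>\<^sub>u n'" "r = n' \<bullet>\<^sub>u m'" "t = m' \<bullet>\<^sub>o n'" by blast
    then show "\<exists>m n. ?Q Over Up Down p q m n \<and> ?Q s Down Up m n r t"
      using s by (intro exI[of _ m'] exI[of _ n']) (auto simp: crossing_rel_def side_rel_def)
  qed
  \<comment> \<open>For the opposite directions the two kinds trade places, because
    \<open>twist_out_in\<close> starts from the classical crossing below.\<close>
  have DU: "commute ?Q Over s Down Up"
  proof (rule commuteI[OF det(2,1)])
    fix p q m n r t assume "?Q Over Down Up p q m n" "?Q s Up Down m n r t"
    then show "\<exists>m n. ?Q s Down Up p q m n \<and> ?Q Over Up Down m n r t"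
      using twist_out_in[of p q r t] s by (auto simp: crossing_rel_def side_rel_def)
  qed
  have DD: "commute ?Q s Over Down Down"
    using commute_half_turn[of X _ s Over Up Up] commute_Up_Up[OF s, of Over] by simp
  have *: "commute ?Q s Over a b" for a b
    using commute_Up_Up[OF s, of Over] UD DU[unfolded commute_sym[of _ Over]] DD by (cases a; cases b) simp_all
  then have "commute ?Q s (flip Over) a b"
    by (intro commute_flip) (auto intro: determined_classical)
  with * k show ?thesis by auto
qed

end

section \<open>Equivariant bijections\<close>

text \<open>Stability of \<open>A'\<close> under the action follows through the bijection, so only
  that of \<open>A\<close> is recorded.\<close>

definition equivariant ::
  "'h set \<Rightarrow> ('h \<Rightarrow> 'v \<Rightarrow> 'v) \<Rightarrow> 'v set \<Rightarrow> ('h \<Rightarrow> 'w \<Rightarrow> 'w) \<Rightarrow> 'w set \<Rightarrow> bool" where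
  "equivariant S \<alpha> A \<alpha>' A' \<longleftrightarrow> (\<exists>\<beta>. bij_betw \<beta> A A' \<and>
     (\<forall>h\<in>S. \<forall>x\<in>A. \<alpha> h x \<in> A \<and> \<beta> (\<alpha> h x) = \<alpha>' h (\<beta> x)))"

lemma equivariant_sym:
  assumes "equivariant S \<alpha> A \<alpha>' A'" shows "equivariant S \<alpha>' A' \<alpha> A"
proof -
  obtain \<beta> where b: "bij_betw \<beta> A A'"
    and e: "\<And>h x. h \<in> S \<Longrightarrow> x \<in> A \<Longrightarrow> \<alpha> h x \<in> A \<and> \<beta> (\<alpha> h x) = \<alpha>' h (\<beta> x)"
    using assms unfolding equivariant_def by blast
  have "\<alpha>' h x' \<in> A' \<and> inv_into A \<beta> (\<alpha>' h x') = \<alpha> h (inv_into A \<beta> x')"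
    if h: "h \<in> S" and x': "x' \<in> A'" for h x'
  proof -
    obtain x where x: "x \<in> A" "x' = \<beta> x" using b x' by (auto simp: bij_betw_def)
    show ?thesis
      using e[OF h x(1)] x b by (metis bij_betw_apply bij_betw_inv_into_left)
  qed
  with bij_betw_inv_into[OF b] show ?thesis unfolding equivariant_def by blast
qed

lemma equivariant_trans:
  assumes "equivariant S \<alpha> A \<alpha>' A'" "equivariant S \<alpha>' A' \<alpha>'' A''"
  shows "equivariant S \<alpha> A \<alpha>'' A''"
proof -
  obtain \<beta> where b: "bij_betw \<beta> A A'"
    and e: "\<And>h x. h \<in> S \<Longrightarrow> x \<in> A \<Longrightarrow> \<alpha> h x \<in> A \<and> \<beta> (\<alpha> h x) = \<alpha>' h (\<beta> x)"
    using assms(1) unfolding equivariant_def by blast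
  obtain \<gamma> where c: "bij_betw \<gamma> A' A''"
    and f: "\<And>h x. h \<in> S \<Longrightarrow> x \<in> A' \<Longrightarrow> \<alpha>' h x \<in> A' \<and> \<gamma> (\<alpha>' h x) = \<alpha>'' h (\<gamma> x)"
    using assms(2) unfolding equivariant_def by blast
  have "\<beta> x \<in> A'" if "x \<in> A" for x using b that by (rule bij_betw_apply)
  then show ?thesis unfolding equivariant_def
    by (intro exI[of _ "\<gamma> \<circ> \<beta>"]) (auto simp: e f intro: bij_betw_trans[OF b c])
qed

text \<open>Matching labellings are known only through the existence of fillings. A relation that is
  total and unique in both directions and respected by the action is the graph of the desired
  bijection.\<close>

lemma equivariant_relI:
  assumes total: "\<And>x. x \<in> A \<Longrightarrow> \<exists>x'\<in>A'. R x x'" "\<And>x'. x' \<in> A' \<Longrightarrow> \<exists>x\<in>A. R x x'"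
    and unique: "\<And>x x' y'. R x x' \<Longrightarrow> R x y' \<Longrightarrow> x' = y'" "\<And>x y x'. R x x' \<Longrightarrow> R y x' \<Longrightarrow> x = y"
    and act: "\<And>h x. h \<in> S \<Longrightarrow> x \<in> A \<Longrightarrow> \<alpha> h x \<in> A"
      "\<And>h x x'. h \<in> S \<Longrightarrow> R x x' \<Longrightarrow> R (\<alpha> h x) (\<alpha>' h x')"
  shows "equivariant S \<alpha> A \<alpha>' A'"
proof -
  define \<beta> where "\<beta> x = (THE x'. R x x')" for x
  have \<beta>: "\<beta> x = x'" if "R x x'" for x x'
    unfolding \<beta>_def using that unique(1) by blast
  have "bij_betw \<beta> A A'" unfolding bij_betw_def inj_on_def
  proof (intro conjI ballI impI set_eqI iffI)
    show "x = y" if xy: "x \<in> A" "y \<in> A" "\<beta> x = \<beta> y" for x y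
    proof -
      obtain x' y' where R: "R x x'" "R y y'" using total(1) xy(1,2) by blast
      then show ?thesis using \<beta>[OF R(1)] \<beta>[OF R(2)] xy(3) unique(2) by simp
    qed
    show "x' \<in> A'" if "x' \<in> \<beta> ` A" for x'
      using that total(1) \<beta> by blast
    show "x' \<in> \<beta> ` A" if "x' \<in> A'" for x'
      using total(2)[OF that] \<beta> by blast
  qed
  moreover have "\<beta> (\<alpha> h x) = \<alpha>' h (\<beta> x)" if "h \<in> S" "x \<in> A" for h x
    using total(1)[OF that(2)] act(2)[OF that(1)] \<beta> by blast
  ultimately show ?thesis unfolding equivariant_def using act(1) by blast
qed

section \<open>Labelling the lines of a diagram\<close>

primrec typed :: "tangle \<Rightarrow> dir list \<Rightarrow> dir list \<Rightarrow> bool" where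
  "typed [] u v \<longleftrightarrow> u = v"
| "typed (s # D) u v \<longleftrightarrow> slice_bot s = u \<and> typed D (slice_top s) v"

lemma typed_append: "typed (D @ E) u v \<longleftrightarrow> (\<exists>w. typed D u w \<and> typed E w v)"
  by (induction D arbitrary: u) auto

lemma typed_chain:
  assumes "D \<noteq> []" "\<And>i. Suc i < length D \<Longrightarrow> slice_top (D ! i) = slice_bot (D ! Suc i)"
  shows "typed D (slice_bot (hd D)) (slice_top (last D))"
  using assms
proof (induction D)
  case (Cons s D)
  show ?case
  proof (cases "D = []")
    case False
    then have "slice_top s = slice_bot (hd D)"
      using Cons.prems(2)[of 0] by (simp add: hd_conv_nth)
    moreover have "typed D (slice_bot (hd D)) (slice_top (last D))"
      using Cons.IH[OF False] Cons.prems(2)[of "Suc _"] by auto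
    ultimately show ?thesis using False by simp
  qed simp
qed simp

lemma typed_closed_tangle: "closed_tangle D \<Longrightarrow> typed D [] []"
  using typed_chain[of D] by (cases "D = []") (auto simp: closed_tangle_def)

locale label_rule =
  fixes C :: "'a set" and Q :: "kind \<Rightarrow> dir \<Rightarrow> dir \<Rightarrow> 'a \<Rightarrow> 'a \<Rightarrow> 'a \<Rightarrow> 'a \<Rightarrow> bool"
  assumes Q_carrier: "Q k a b p q r s \<Longrightarrow> p \<in> C \<and> q \<in> C \<and> r \<in> C \<and> s \<in> C"
begin

fun piece_rel :: "piece \<Rightarrow> 'a list \<Rightarrow> 'a list \<Rightarrow> bool" where
  "piece_rel (Crossing k a b) xs ys \<longleftrightarrow> (\<exists>p q r s. xs = [p, q] \<and> ys = [r, s] \<and> Q k a b p q r s)"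
| "piece_rel (Cup d) xs ys \<longleftrightarrow> xs = [] \<and> (\<exists>y\<in>C. ys = [y, y])"
| "piece_rel (Cap d) xs ys \<longleftrightarrow> ys = [] \<and> (\<exists>x\<in>C. xs = [x, x])"

fun slice_rel :: "slice \<Rightarrow> 'a list \<Rightarrow> 'a list \<Rightarrow> bool" where
  "slice_rel (l, e, r) xs ys \<longleftrightarrow> (\<exists>us xe ye ws. xs = us @ xe @ ws \<and> ys = us @ ye @ ws \<and>
     length us = length l \<and> length ws = length r \<and> set us \<subseteq> C \<and> set ws \<subseteq> C \<and> piece_rel e xe ye)"

text \<open>The list \<open>cs\<close> holds the line above each slice. It thus contains the top
  line \<open>ys\<close> unless the tangle is empty, but not the bottom line \<open>xs\<close>, so
  that lists of stacked tangles concatenate.\<close>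

primrec colored :: "tangle \<Rightarrow> 'a list \<Rightarrow> 'a list list \<Rightarrow> 'a list \<Rightarrow> bool" where
  "colored [] xs cs ys \<longleftrightarrow> cs = [] \<and> xs = ys"
| "colored (s # D) xs cs ys \<longleftrightarrow> (\<exists>zs cs'. cs = zs # cs' \<and> slice_rel s xs zs \<and> colored D zs cs' ys)"

declare slice_rel.simps [simp del]

lemma slice_relI:
  "\<lbrakk>piece_rel e xe ye; length us = length l; length ws = length r; set us \<subseteq> C; set ws \<subseteq> C\<rbrakk> \<Longrightarrow>
    slice_rel (l, e, r) (us @ xe @ ws) (us @ ye @ ws)"
  unfolding slice_rel.simps by blast

lemma slice_relE:
  assumes "slice_rel (l, e, r) xs ys"
  obtains us xe ye ws where "xs = us @ xe @ ws" "ys = us @ ye @ ws" "length us = length l"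
    "length ws = length r" "set us \<subseteq> C" "set ws \<subseteq> C" "piece_rel e xe ye"
  using assms unfolding slice_rel.simps by blast

lemma piece_rel_shape:
  "piece_rel e xs ys \<Longrightarrow> length xs = length (piece_bot e) \<and> length ys = length (piece_top e) \<and>
    set xs \<subseteq> C \<and> set ys \<subseteq> C"
  by (cases e) (auto dest: Q_carrier)

lemma slice_rel_shape:
  "slice_rel s xs ys \<Longrightarrow> length xs = length (slice_bot s) \<and> length ys = length (slice_top s) \<and>
    set xs \<subseteq> C \<and> set ys \<subseteq> C"
  by (cases s) (auto simp: slice_rel.simps subset_eq dest!: piece_rel_shape)

lemma colored_append:
  "colored (D @ E) xs cs ys \<longleftrightarrow>
    (\<exists>cs1 zs cs2. cs = cs1 @ cs2 \<and> colored D xs cs1 zs \<and> colored E zs cs2 ys)"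
proof (induction D arbitrary: xs cs)
  case (Cons s D)
  show ?case by (simp add: Cons.IH) (metis append_Cons)
qed simp

lemma colored_length: "colored D xs cs ys \<Longrightarrow> length cs = length D"
  by (induction D arbitrary: xs cs) auto

lemma colored_last: "colored D xs cs ys \<Longrightarrow> ys = last (xs # cs)"
  by (induction D arbitrary: xs cs) auto

lemma colored_shape:
  "\<lbrakk>colored D xs cs ys; typed D u v; length xs = length u; set xs \<subseteq> C\<rbrakk> \<Longrightarrow>
    length ys = length v \<and> set ys \<subseteq> C"
proof (induction D arbitrary: xs cs u)
  case (Cons s D)
  then show ?case by (auto dest!: slice_rel_shape)
qed simp

lemma colored_iff_nth:
  "colored D xs cs ys \<longleftrightarrow> length cs = length D \<and> ys = last (xs # cs) \<and>
    (\<forall>i<length D. slice_rel (D ! i) ((xs # cs) ! i) (cs ! i))"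
proof (induction D arbitrary: xs cs)
  case (Cons s D)
  show ?case
  proof (cases cs)
    case (Cons zs cs')
    then show ?thesis by (simp add: Cons.IH All_less_Suc2) blast
  qed simp
qed auto

lemma colored_map:
  assumes h: "\<And>x. x \<in> C \<Longrightarrow> h x \<in> C"
    "\<And>k a b p q r s. Q k a b p q r s \<Longrightarrow> Q k a b (h p) (h q) (h r) (h s)"
  shows "colored D xs cs ys \<Longrightarrow> colored D (map h xs) (map (map h) cs) (map h ys)"
proof (induction D arbitrary: xs cs)
  case (Cons s D)
  have piece: "piece_rel e (map h xs) (map h ys)" if "piece_rel e xs ys" for e xs ys
    using that h by (cases e) auto
  have "slice_rel s (map h xs) (map h zs)" if slice: "slice_rel s xs zs" for xs zs
  proof -
    obtain l e r where s: "s = (l, e, r)" by (cases s)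
    with slice obtain us xe ye ws where *: "xs = us @ xe @ ws" "zs = us @ ye @ ws"
      "length us = length l" "length ws = length r" "set us \<subseteq> C" "set ws \<subseteq> C" "piece_rel e xe ye"
      by (auto simp: slice_rel.simps)
    then show ?thesis unfolding s slice_rel.simps using h(1) piece
      by (intro exI[of _ "map h us"] exI[of _ "map h xe"] exI[of _ "map h ye"] exI[of _ "map h ws"]) auto
  qed
  with Cons show ?case by auto
qed simp

section \<open>Padding by vertical strands and replacing a tangle inside a diagram\<close>

lemma slice_rel_pad:
  assumes "length us = length l" "length ws = length r" "set us \<subseteq> C" "set ws \<subseteq> C"
  shows "slice_rel (l @ l', e, r' @ r) (us @ xs @ ws) ys \<longleftrightarrow>
    (\<exists>zs. ys = us @ zs @ ws \<and> slice_rel (l', e, r') xs zs)"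
proof
  assume "slice_rel (l @ l', e, r' @ r) (us @ xs @ ws) ys"
  then obtain us1 xe ye ws1 where *: "us @ xs @ ws = us1 @ xe @ ws1" "ys = us1 @ ye @ ws1"
    "length us1 = length l + length l'" "length ws1 = length r' + length r"
    "set us1 \<subseteq> C" "set ws1 \<subseteq> C" "piece_rel e xe ye"
    by (auto simp: slice_rel.simps)
  define us2 where "us2 = drop (length l) us1"
  define ws2 where "ws2 = take (length r') ws1"
  \<comment> \<open>The relation only supplies some splitting of the lines. Comparing prefixes and
    then suffixes shows that \<open>us\<close> and \<open>ws\<close> can be split off from
    it.\<close>
  have "take (length l) (us @ xs @ ws) = take (length l) (us1 @ xe @ ws1)" using *(1) by simp
  then have us1: "us1 = us @ us2"
    using assms(1) *(3) append_take_drop_id[of "length l" us1] by (simp add: us2_def)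
  have "drop (length (xs @ ws) - length r) (xs @ ws) = drop (length (xs @ ws) - length r) (us2 @ xe @ ws1)"
    using *(1) us1 by simp
  moreover have len: "length xs + length ws = length us2 + length xe + length ws1"
    using arg_cong[OF *(1), of length] us1 by simp
  ultimately have "ws = drop (length r') ws1"
    using assms(2) *(4) by (simp add: drop_append)
  then have ws1: "ws1 = ws2 @ ws" by (simp add: ws2_def)
  have xs: "xs = us2 @ xe @ ws2" using *(1) by (simp add: us1 ws1)
  have "length us2 = length l'" "length ws2 = length r'" "set us2 \<subseteq> C" "set ws2 \<subseteq> C"
    using *(3-6) us1 ws1 assms by auto
  with xs *(7) have "slice_rel (l', e, r') xs (us2 @ ye @ ws2)"
    unfolding slice_rel.simps by blast
  moreover have "ys = us @ (us2 @ ye @ ws2) @ ws" using *(2) us1 ws1 by simp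
  ultimately show "\<exists>zs. ys = us @ zs @ ws \<and> slice_rel (l', e, r') xs zs" by blast
next
  assume "\<exists>zs. ys = us @ zs @ ws \<and> slice_rel (l', e, r') xs zs"
  then obtain us2 xe ye ws2 where "ys = us @ (us2 @ ye @ ws2) @ ws" "xs = us2 @ xe @ ws2"
    "length us2 = length l'" "length ws2 = length r'" "set us2 \<subseteq> C" "set ws2 \<subseteq> C" "piece_rel e xe ye"
    by (auto simp: slice_rel.simps)
  then show "slice_rel (l @ l', e, r' @ r) (us @ xs @ ws) ys"
    using assms unfolding slice_rel.simps
    by (intro exI[of _ "us @ us2"] exI[of _ xe] exI[of _ ye] exI[of _ "ws2 @ ws"]) auto
qed

lemma colored_pad:
  assumes "length us = length l" "length ws = length r" "set us \<subseteq> C" "set ws \<subseteq> C"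
  shows "colored (pad l r T) (us @ xs @ ws) cs ys \<longleftrightarrow>
    (\<exists>ds zs. cs = map (\<lambda>c. us @ c @ ws) ds \<and> ys = us @ zs @ ws \<and> colored T xs ds zs)"
proof (induction T arbitrary: xs cs)
  case Nil
  show ?case by (auto simp: pad_def)
next
  case (Cons s T)
  obtain l' e r' where s: "s = (l', e, r')" by (cases s)
  have "colored (pad l r (s # T)) (us @ xs @ ws) cs ys \<longleftrightarrow>
      (\<exists>zs cs'. cs = (us @ zs @ ws) # cs' \<and> slice_rel s xs zs \<and> colored (pad l r T) (us @ zs @ ws) cs' ys)"
    using slice_rel_pad[OF assms] by (auto simp: pad_def s)
  also have "\<dots> \<longleftrightarrow> (\<exists>ds zs. cs = map (\<lambda>c. us @ c @ ws) ds \<and> ys = us @ zs @ ws \<and> colored (s # T) xs ds zs)"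
    unfolding Cons.IH by auto (metis list.simps(9))
  finally show ?case .
qed

text \<open>The empty tangle relates every list to itself, whatever its length and entries;
  therefore only bottom lists of length \<open>n\<close> over \<open>C\<close> are considered.
  Fillings are unique once both boundary lists are fixed.\<close>

definition interchangeable :: "nat \<Rightarrow> tangle \<Rightarrow> tangle \<Rightarrow> bool" where
  "interchangeable n T T' \<longleftrightarrow> (\<forall>xs ys. length xs = n \<and> set xs \<subseteq> C \<longrightarrow>
     ((\<exists>cs. colored T xs cs ys) \<longleftrightarrow> (\<exists>cs. colored T' xs cs ys)) \<and>
     (\<forall>cs cs'. colored T xs cs ys \<longrightarrow> colored T xs cs' ys \<longrightarrow> cs = cs') \<and>
     (\<forall>cs cs'. colored T' xs cs ys \<longrightarrow> colored T' xs cs' ys \<longrightarrow> cs = cs'))"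

lemma interchangeable_pad:
  assumes "interchangeable n T T'"
  shows "interchangeable (length l + n + length r) (pad l r T) (pad l r T')"
  unfolding interchangeable_def
proof (intro allI impI)
  fix xs ys assume xs: "length xs = length l + n + length r \<and> set xs \<subseteq> C"
  define us where "us = take (length l) xs"
  define zs where "zs = take n (drop (length l) xs)"
  define ws where "ws = drop (length l + n) xs"
  have split: "xs = us @ zs @ ws"
    by (simp add: us_def zs_def ws_def) (metis add.commute append_take_drop_id drop_drop)
  have len: "length us = length l" "length ws = length r" "length zs = n"
    using xs by (auto simp: us_def zs_def ws_def)
  have sub: "set us \<subseteq> C" "set ws \<subseteq> C" "set zs \<subseteq> C" using xs split by auto
  have I: "(\<exists>cs. colored T zs cs ys) \<longleftrightarrow> (\<exists>cs. colored T' zs cs ys)"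
     "colored T zs cs ys \<Longrightarrow> colored T zs cs' ys \<Longrightarrow> cs = cs'"
     "colored T' zs cs ys \<Longrightarrow> colored T' zs cs' ys \<Longrightarrow> cs = cs'" for cs cs' ys
    using assms len(3) sub(3) unfolding interchangeable_def by blast+
  note P = colored_pad[OF len(1,2) sub(1,2)]
  show "((\<exists>cs. colored (pad l r T) xs cs ys) \<longleftrightarrow> (\<exists>cs. colored (pad l r T') xs cs ys)) \<and>
     (\<forall>cs cs'. colored (pad l r T) xs cs ys \<longrightarrow> colored (pad l r T) xs cs' ys \<longrightarrow> cs = cs') \<and>
     (\<forall>cs cs'. colored (pad l r T') xs cs ys \<longrightarrow> colored (pad l r T') xs cs' ys \<longrightarrow> cs = cs')"
    unfolding split P
  proof (intro conjI allI impI)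
    show "(\<exists>cs ds zsa. cs = map (\<lambda>c. us @ c @ ws) ds \<and> ys = us @ zsa @ ws \<and> colored T zs ds zsa) =
      (\<exists>cs ds zsa. cs = map (\<lambda>c. us @ c @ ws) ds \<and> ys = us @ zsa @ ws \<and> colored T' zs ds zsa)"
      using I(1) by blast
  qed (use I(2,3) in fastforce)+
qed

lemma equivariant_local_move:
  assumes D: "typed (lo @ pad l r T @ hi) [] []" "typed (lo @ pad l r T' @ hi) [] []"
    and T: "T \<noteq> []" "interchangeable (length (slice_bot (hd T))) T T'"
    and h: "\<And>h x. h \<in> S \<Longrightarrow> x \<in> C \<Longrightarrow> h x \<in> C"
    "\<And>h k a b p q r s. h \<in> S \<Longrightarrow> Q k a b p q r s \<Longrightarrow> Q k a b (h p) (h q) (h r) (h s)"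
  shows "equivariant S (\<lambda>h. map (map h)) {cs. colored (lo @ pad l r T @ hi) [] cs []}
    (\<lambda>h. map (map h)) {cs. colored (lo @ pad l r T' @ hi) [] cs []}"
proof -
  let ?P = "pad l r T" and ?P' = "pad l r T'"
  define n where "n = length l + length (slice_bot (hd T)) + length r"
  \<comment> \<open>The directions carried by the diagram fix the number of points below the
    replaced block, so the restriction in \<open>interchangeable\<close> is met.\<close>
  have bottom: "length xs = n \<and> set xs \<subseteq> C" if "colored lo [] cs xs" for cs xs
  proof -
    obtain w v where "typed lo [] w" "typed ?P w v" using D(1) by (auto simp: typed_append)
    moreover from this(2) T(1) have "length w = n"
      by (cases T) (auto simp: pad_def n_def split: prod.splits)
    ultimately show ?thesis using colored_shape[OF that] by simp
  qed
  have I: "(\<exists>cs. colored ?P xs cs ys) \<longleftrightarrow> (\<exists>cs. colored ?P' xs cs ys)"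
     "colored ?P xs cs ys \<Longrightarrow> colored ?P xs cs' ys \<Longrightarrow> cs = cs'"
     "colored ?P' xs cs ys \<Longrightarrow> colored ?P' xs cs' ys \<Longrightarrow> cs = cs'"
    if "colored lo [] cs0 xs" for cs0 xs ys cs cs'
    using interchangeable_pad[OF T(2), of l r] bottom[OF that]
    unfolding interchangeable_def n_def by blast+
  define R where "R cs cs' \<longleftrightarrow> (\<exists>cs1 xs cs2 cs2' ys cs3. cs = cs1 @ cs2 @ cs3 \<and> cs' = cs1 @ cs2' @ cs3 \<and>
    colored lo [] cs1 xs \<and> colored ?P xs cs2 ys \<and> colored ?P' xs cs2' ys \<and> colored hi ys cs3 [])"
    for cs cs'
  show ?thesis
  proof (rule equivariant_relI[where R = R]; (elim CollectE)?)
    fix cs assume "colored (lo @ ?P @ hi) [] cs []"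
    then obtain cs1 xs cs2 ys cs3 where *: "cs = cs1 @ cs2 @ cs3" "colored lo [] cs1 xs"
      "colored ?P xs cs2 ys" "colored hi ys cs3 []"
      unfolding colored_append by blast
    then obtain cs2' where "colored ?P' xs cs2' ys" using I(1) by blast
    with * have "colored (lo @ ?P' @ hi) [] (cs1 @ cs2' @ cs3) []" "R cs (cs1 @ cs2' @ cs3)"
      unfolding colored_append R_def by blast+
    then show "\<exists>x'\<in>{cs. colored (lo @ ?P' @ hi) [] cs []}. R cs x'" by blast
  next
    fix cs assume "colored (lo @ ?P' @ hi) [] cs []"
    then obtain cs1 xs cs2' ys cs3 where *: "cs = cs1 @ cs2' @ cs3" "colored lo [] cs1 xs"
      "colored ?P' xs cs2' ys" "colored hi ys cs3 []"
      unfolding colored_append by blast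
    then obtain cs2 where "colored ?P xs cs2 ys" using I(1) by blast
    with * have "colored (lo @ ?P @ hi) [] (cs1 @ cs2 @ cs3) []" "R (cs1 @ cs2 @ cs3) cs"
      unfolding colored_append R_def by blast+
    then show "\<exists>x\<in>{cs. colored (lo @ ?P @ hi) [] cs []}. R x cs" by blast
  next
    fix x x' y' assume R: "R x x'" "R x y'"
    obtain cs1 xs cs2 cs2' ys cs3 where 1: "x = cs1 @ cs2 @ cs3" "x' = cs1 @ cs2' @ cs3"
      "colored lo [] cs1 xs" "colored ?P xs cs2 ys" "colored ?P' xs cs2' ys"
      using R(1) unfolding R_def by blast
    obtain ds1 xs' ds2 ds2' ys' ds3 where 2: "x = ds1 @ ds2 @ ds3" "y' = ds1 @ ds2' @ ds3"
      "colored lo [] ds1 xs'" "colored ?P xs' ds2 ys'" "colored ?P' xs' ds2' ys'"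
      using R(2) unfolding R_def by blast
    \<comment> \<open>The cuts between the parts are at fixed heights, so lengths alone show that
      both decompositions of the common labelling coincide.\<close>
    have "cs1 = ds1" "cs2 = ds2" "cs3 = ds3"
      using 1(1) 2(1) colored_length[OF 1(3)] colored_length[OF 2(3)]
        colored_length[OF 1(4)] colored_length[OF 2(4)] by auto
    moreover from this have "xs = xs'" "ys = ys'"
      using colored_last[OF 1(3)] colored_last[OF 2(3)] colored_last[OF 1(4)] colored_last[OF 2(4)] by auto
    ultimately show "x' = y'" using 1 2 I(3)[OF 1(3,5)] by simp
  next
    fix x y x' assume R: "R x x'" "R y x'"
    obtain cs1 xs cs2 cs2' ys cs3 where 1: "x = cs1 @ cs2 @ cs3" "x' = cs1 @ cs2' @ cs3"
      "colored lo [] cs1 xs" "colored ?P xs cs2 ys" "colored ?P' xs cs2' ys"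
      using R(1) unfolding R_def by blast
    obtain ds1 xs' ds2 ds2' ys' ds3 where 2: "y = ds1 @ ds2 @ ds3" "x' = ds1 @ ds2' @ ds3"
      "colored lo [] ds1 xs'" "colored ?P xs' ds2 ys'" "colored ?P' xs' ds2' ys'"
      using R(2) unfolding R_def by blast
    have "cs1 = ds1" "cs2' = ds2'" "cs3 = ds3"
      using 1(2) 2(2) colored_length[OF 1(3)] colored_length[OF 2(3)]
        colored_length[OF 1(5)] colored_length[OF 2(5)] by auto
    moreover from this have "xs = xs'" "ys = ys'"
      using colored_last[OF 1(3)] colored_last[OF 2(3)] colored_last[OF 1(5)] colored_last[OF 2(5)] by auto
    ultimately show "x = y" using 1 2 I(2)[OF 1(3,4)] by simp
  next
    fix h cs assume "h \<in> S" "colored (lo @ ?P @ hi) [] cs []"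
    then show "map (map h) cs \<in> {cs. colored (lo @ ?P @ hi) [] cs []}"
      using colored_map[of h _ "[]" cs "[]"] h by simp
  next
    fix k x x' assume "k \<in> S" and R: "R x x'"
    then have k: "\<And>D xs cs ys. colored D xs cs ys \<Longrightarrow> colored D (map k xs) (map (map k) cs) (map k ys)"
      using h by (intro colored_map) auto
    obtain cs1 xs cs2 cs2' ys cs3 where 1: "x = cs1 @ cs2 @ cs3" "x' = cs1 @ cs2' @ cs3"
      "colored lo [] cs1 xs" "colored ?P xs cs2 ys" "colored ?P' xs cs2' ys" "colored hi ys cs3 []"
      using R(1) unfolding R_def by blast
    with k[OF 1(3)] k[OF 1(4)] k[OF 1(5)] k[OF 1(6)]
    show "R (map (map k) x) (map (map k) x')"
      unfolding R_def by (intro exI[of _ "map (map k) cs1"] exI[of _ "map k xs"] exI[of _ "map (map k) cs2"]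
        exI[of _ "map (map k) cs2'"] exI[of _ "map k ys"] exI[of _ "map (map k) cs3"]) simp
  qed
qed

end

section \<open>Semiarcs\<close>

lemma closed_tangle_top:
  assumes "closed_tangle D" "i < length D" "j < length (slice_top (D ! i))"
  shows "Suc i < length D" "slice_top (D ! i) = slice_bot (D ! Suc i)"
proof -
  show "Suc i < length D"
  proof (rule ccontr)
    assume "\<not> Suc i < length D"
    then have "i = length D - 1" "D \<noteq> []" using assms(2) by auto
    then have "D ! i = last D" by (simp add: last_conv_nth)
    with \<open>D \<noteq> []\<close> show False using assms by (auto simp: closed_tangle_def)
  qed
  then show "slice_top (D ! i) = slice_bot (D ! Suc i)"
    using assms(1) by (simp add: closed_tangle_def)
qed

lemma points_bot: "\<lbrakk>i < length D; j < length (slice_bot (D ! i))\<rbrakk> \<Longrightarrow> (i, j) \<in> points D"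
  by (simp add: points_def)

lemma points_top:
  assumes "closed_tangle D" "i < length D" "j < length (slice_top (D ! i))"
  shows "(Suc i, j) \<in> points D"
  using closed_tangle_top[OF assms] assms by (simp add: points_def)

lemma semiarc_joined: "joined D p q \<Longrightarrow> semiarc D p = semiarc D q"
  unfolding semiarc_def
  by (auto intro: equivclp_trans r_into_equivclp equivclp_sym)

lemma constant_on_semiarc:
  assumes D: "closed_tangle D" and g: "\<And>p q. joined D p q \<Longrightarrow> g p = g q"
    and "q \<in> points D" "semiarc D p = semiarc D q"
  shows "g p = g q"
proof -
  have "q \<in> semiarc D q" using assms(3) by (simp add: semiarc_def)
  then have "q \<in> semiarc D p" using assms(4) by simp
  then have "equivclp (joined D) p q" by (simp add: semiarc_def)
  then show ?thesis by (induction rule: equivclp_induct) (use g in auto)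
qed

context label_rule
begin

text \<open>The pointwise conditions mirror the rules of \<open>joined\<close>: strands to the left,
  strands to the right, minima and maxima. Virtual crossings are left to \<open>Q\<close>.\<close>

lemma slice_rel_iff_nth:
  "slice_rel (l, e, r) xs ys \<longleftrightarrow>
     length xs = length (slice_bot (l, e, r)) \<and> length ys = length (slice_top (l, e, r)) \<and>
     set xs \<subseteq> C \<and> set ys \<subseteq> C \<and> (\<forall>j<length l. xs ! j = ys ! j) \<and>
     (\<forall>j<length r. xs ! (length l + length (piece_bot e) + j) = ys ! (length l + length (piece_top e) + j)) \<and>
     (case e of
        Crossing k a b \<Rightarrow> Q k a b (xs ! length l) (xs ! Suc (length l)) (ys ! length l) (ys ! Suc (length l))
      | Cup d \<Rightarrow> ys ! length l = ys ! Suc (length l)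
      | Cap d \<Rightarrow> xs ! length l = xs ! Suc (length l))"
    (is "?L \<longleftrightarrow> ?R")
proof
  assume L: ?L
  then obtain us xe ye ws where *: "xs = us @ xe @ ws" "ys = us @ ye @ ws"
    "length us = length l" "length ws = length r" "piece_rel e xe ye"
    by (auto simp: slice_rel.simps)
  moreover have "length xe = length (piece_bot e)" "length ye = length (piece_top e)"
    using piece_rel_shape[OF *(5)] by auto
  ultimately show ?R
    using slice_rel_shape[OF L] by (cases e) (auto simp: nth_append)
next
  assume R: ?R
  define us where "us = take (length l) xs"
  define xe where "xe = take (length (piece_bot e)) (drop (length l) xs)"
  define ye where "ye = take (length (piece_top e)) (drop (length l) ys)"
  define ws where "ws = drop (length l + length (piece_bot e)) xs"
  have us: "us = take (length l) ys" using R by (auto simp: us_def intro!: nth_equalityI)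
  have ws: "ws = drop (length l + length (piece_top e)) ys"
    using R by (auto simp: ws_def intro!: nth_equalityI)
  have xs: "xs = us @ xe @ ws"
    by (simp add: us_def xe_def ws_def) (metis add.commute append_take_drop_id drop_drop)
  have ys: "ys = us @ ye @ ws"
    by (simp add: us ye_def ws) (metis add.commute append_take_drop_id drop_drop)
  have len: "length us = length l" "length ws = length r" "length xe = length (piece_bot e)"
      "length ye = length (piece_top e)"
    using R by (auto simp: us_def ws_def xe_def ye_def)
  have sub: "set us \<subseteq> C" "set ws \<subseteq> C" "set xe \<subseteq> C" "set ye \<subseteq> C"
    using R xs ys by auto
  have "piece_rel e xe ye"
  proof (cases e)
    case (Crossing k a b)
    then obtain p q s t where "xe = [p, q]" "ye = [s, t]"
      using len(3,4) by (auto simp: length_Suc_conv)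
    then show ?thesis using R Crossing len(1) unfolding xs ys by (simp add: nth_append)
  next
    case (Cup d)
    then obtain s t where "xe = []" "ye = [s, t]"
      using len(3,4) by (auto simp: length_Suc_conv)
    then show ?thesis using R Cup len(1) sub unfolding xs ys by (simp add: nth_append)
  next
    case (Cap d)
    then obtain s t where "ye = []" "xe = [s, t]"
      using len(3,4) by (auto simp: length_Suc_conv)
    then show ?thesis using R Cap len(1) sub unfolding xs ys by (simp add: nth_append)
  qed
  with xs ys len sub show ?L unfolding slice_rel.simps by blast
qed

definition arc_coloring :: "tangle \<Rightarrow> (point set \<Rightarrow> 'a) \<Rightarrow> bool" where
  "arc_coloring D f \<longleftrightarrow> f \<in> semiarcs D \<rightarrow>\<^sub>E C \<and>
    (\<forall>i l k a b r. i < length D \<longrightarrow> D ! i = (l, Crossing k a b, r) \<longrightarrow>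
       Q k a b (f (semiarc D (i, length l))) (f (semiarc D (i, Suc (length l))))
         (f (semiarc D (Suc i, length l))) (f (semiarc D (Suc i, Suc (length l)))))"

text \<open>Entry \<open>i\<close> is the line above slice \<open>i\<close>, hence the point index
  \<open>Suc i\<close>. Prefixing \<open>[]\<close>, the bottom line of a closed tangle, shifts this
  to the lines below the slices.\<close>

definition lines :: "tangle \<Rightarrow> (point set \<Rightarrow> 'a) \<Rightarrow> 'a list list" where
  "lines D f = map (\<lambda>i. map (\<lambda>j. f (semiarc D (Suc i, j))) [0..<length (slice_top (D ! i))]) [0..<length D]"

lemma lines_nth_top:
  "i < length D \<Longrightarrow> lines D f ! i = map (\<lambda>j. f (semiarc D (Suc i, j))) [0..<length (slice_top (D ! i))]"
  by (simp add: lines_def)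

lemma lines_nth_bot:
  assumes "closed_tangle D" "i < length D"
  shows "([] # lines D f) ! i = map (\<lambda>j. f (semiarc D (i, j))) [0..<length (slice_bot (D ! i))]"
proof (cases i)
  case 0
  then show ?thesis using assms by (auto simp: closed_tangle_def hd_conv_nth)
next
  case (Suc i')
  then show ?thesis using assms by (auto simp: closed_tangle_def lines_nth_top)
qed

lemma colored_lines:
  assumes D: "closed_tangle D" and f: "arc_coloring D f"
  shows "colored D [] (lines D f) []"
  unfolding colored_iff_nth
proof (intro conjI allI impI)
  show "length (lines D f) = length D" by (simp add: lines_def)
  show "[] = last ([] # lines D f)"
    using D by (auto simp: closed_tangle_def last_conv_nth lines_def last_map)
next
  fix i assume i: "i < length D"
  obtain l e r where s: "D ! i = (l, e, r)" by (cases "D ! i")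
  have C: "f (semiarc D p) \<in> C" if "p \<in> points D" for p
    using f that by (auto simp: arc_coloring_def semiarcs_def)
  note J = semiarc_joined[OF joined.left[OF i s]] semiarc_joined[OF joined.right[OF i s]]
  show "slice_rel (D ! i) (([] # lines D f) ! i) (lines D f ! i)"
    unfolding lines_nth_bot[OF D i] lines_nth_top[OF i] unfolding s slice_rel_iff_nth
  proof (intro conjI)
    show "set (map (\<lambda>j. f (semiarc D (i, j))) [0..<length (slice_bot (l, e, r))]) \<subseteq> C"
      using C points_bot[OF i] s by auto
    show "set (map (\<lambda>j. f (semiarc D (Suc i, j))) [0..<length (slice_top (l, e, r))]) \<subseteq> C"
      using C points_top[OF D i] s by auto
    show "case e of
        Crossing k a b \<Rightarrow> Q k a b
          (map (\<lambda>j. f (semiarc D (i, j))) [0..<length (slice_bot (l, e, r))] ! length l)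
          (map (\<lambda>j. f (semiarc D (i, j))) [0..<length (slice_bot (l, e, r))] ! Suc (length l))
          (map (\<lambda>j. f (semiarc D (Suc i, j))) [0..<length (slice_top (l, e, r))] ! length l)
          (map (\<lambda>j. f (semiarc D (Suc i, j))) [0..<length (slice_top (l, e, r))] ! Suc (length l))
      | Cup d \<Rightarrow> map (\<lambda>j. f (semiarc D (Suc i, j))) [0..<length (slice_top (l, e, r))] ! length l =
          map (\<lambda>j. f (semiarc D (Suc i, j))) [0..<length (slice_top (l, e, r))] ! Suc (length l)
      | Cap d \<Rightarrow> map (\<lambda>j. f (semiarc D (i, j))) [0..<length (slice_bot (l, e, r))] ! length l =
          map (\<lambda>j. f (semiarc D (i, j))) [0..<length (slice_bot (l, e, r))] ! Suc (length l)"
    proof (cases e)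
      case (Crossing k a b)
      then show ?thesis using f i s by (simp add: arc_coloring_def del: upt_Suc)
    next
      case (Cup d)
      then show ?thesis using semiarc_joined[OF joined.cup[OF i, of l d r]] s by (simp del: upt_Suc)
    next
      case (Cap d)
      then show ?thesis using semiarc_joined[OF joined.cap[OF i, of l d r]] s by (simp del: upt_Suc)
    qed
  qed (use J in auto)
qed

lemma lines_cancel:
  assumes D: "closed_tangle D" and fg: "arc_coloring D f" "arc_coloring D g" and eq: "lines D f = lines D g"
  shows "f = g"
proof -
  have "f (semiarc D p) = g (semiarc D p)" if p: "p \<in> points D" for p
  proof -
    obtain i j where p: "p = (i, j)" "i < length D" "j < length (slice_bot (D ! i))"
      using p by (auto simp: points_def)
    then show ?thesis
      using arg_cong[OF eq, of "\<lambda>cs. ([] # cs) ! i ! j"] by (simp add: lines_nth_bot[OF D p(2)])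
  qed
  moreover have "f \<in> semiarcs D \<rightarrow>\<^sub>E C" "g \<in> semiarcs D \<rightarrow>\<^sub>E C"
    using fg by (auto simp: arc_coloring_def)
  ultimately show ?thesis by (intro PiE_ext) (auto simp: semiarcs_def)
qed

text \<open>A labelling of points descends to semiarcs if it is constant along
  \<open>joined\<close>. At virtual crossings this is exactly the hypothesis on
  \<open>Q Virtual\<close>.\<close>

lemma lines_surj:
  assumes virt: "\<And>a b p q r s. Q Virtual a b p q r s \<Longrightarrow> p = s \<and> q = r"
    and D: "closed_tangle D" and cs: "colored D [] cs []"
  obtains f where "arc_coloring D f" "lines D f = cs"
proof -
  define g where "g p = ([] # cs) ! fst p ! snd p" for p :: point
  have len: "length cs = length D" and
    rel: "\<And>i. i < length D \<Longrightarrow> slice_rel (D ! i) (([] # cs) ! i) (cs ! i)"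
    using cs by (auto simp: colored_iff_nth)
  have shape: "length (([] # cs) ! i) = length (slice_bot (D ! i))" "length (cs ! i) = length (slice_top (D ! i))"
    "set (([] # cs) ! i) \<subseteq> C" if "i < length D" for i
    using slice_rel_shape[OF rel[OF that]] by auto
  have joined: "g p = g q" if "joined D p q" for p q
    using that
  proof cases
    case (left i l e r j)
    then show ?thesis using rel[of i] by (simp add: slice_rel_iff_nth g_def)
  next
    case (right i l e r j)
    then show ?thesis using rel[of i] by (simp add: slice_rel_iff_nth g_def)
  next
    case (cup i l d r)
    then show ?thesis using rel[of i] by (simp add: slice_rel_iff_nth g_def)
  next
    case (cap i l d r)
    then show ?thesis using rel[of i] by (simp add: slice_rel_iff_nth g_def)
  next
    case (virtual_sw_ne i l a b r)
    then show ?thesis using rel[of i] by (auto simp: slice_rel_iff_nth g_def dest: virt)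
  next
    case (virtual_se_nw i l a b r)
    then show ?thesis using rel[of i] by (auto simp: slice_rel_iff_nth g_def dest: virt)
  qed
  \<comment> \<open>The value on a semiarc is read off at an arbitrary point of the diagram
    representing it; constancy of \<open>g\<close> along semiarcs makes the choice
    immaterial.\<close>
  define f where "f = (\<lambda>A\<in>semiarcs D. g (SOME p. p \<in> points D \<and> semiarc D p = A))"
  have f: "f (semiarc D p) = g p" if p: "p \<in> points D" for p
  proof -
    define q where "q = (SOME q. q \<in> points D \<and> semiarc D q = semiarc D p)"
    have "q \<in> points D \<and> semiarc D q = semiarc D p"
      unfolding q_def by (rule someI[of _ p]) (use p in simp)
    then have "g q = g p" using constant_on_semiarc[where g = g, OF D joined p] by blast
    then show ?thesis using p by (simp add: f_def semiarcs_def q_def)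
  qed
  have top: "g (Suc i, j) = cs ! i ! j" for i j by (simp add: g_def)
  have "arc_coloring D f" unfolding arc_coloring_def
  proof (intro conjI allI impI)
    have "g p \<in> C" if "p \<in> points D" for p
      using that shape by (force simp: points_def g_def)
    then show "f \<in> semiarcs D \<rightarrow>\<^sub>E C"
      using f by (auto simp: semiarcs_def) (auto simp: f_def semiarcs_def)
  next
    fix i l k a b r assume i: "i < length D" and s: "D ! i = (l, Crossing k a b, r)"
    have "(i, length l) \<in> points D" "(i, Suc (length l)) \<in> points D"
      "(Suc i, length l) \<in> points D" "(Suc i, Suc (length l)) \<in> points D"
      using points_bot[OF i] points_top[OF D i] s by auto
    then show "Q k a b (f (semiarc D (i, length l))) (f (semiarc D (i, Suc (length l))))
         (f (semiarc D (Suc i, length l))) (f (semiarc D (Suc i, Suc (length l))))"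
      using rel[OF i] s by (simp add: f top slice_rel_iff_nth) (simp add: g_def)
  qed
  moreover have "lines D f = cs"
  proof (rule nth_equalityI)
    show "length (lines D f) = length cs" by (simp add: lines_def len)
    fix i assume "i < length (lines D f)"
    then have i: "i < length D" by (simp add: lines_def)
    show "lines D f ! i = cs ! i"
      unfolding lines_nth_top[OF i]
      by (rule nth_equalityI) (use i points_top[OF D i] in \<open>auto simp: shape f top\<close>)
  qed
  ultimately show ?thesis using that by blast
qed

lemma equivariant_lines:
  assumes virt: "\<And>a b p q r s. Q Virtual a b p q r s \<Longrightarrow> p = s \<and> q = r"
    and D: "closed_tangle D"
    and h: "\<And>h x. h \<in> S \<Longrightarrow> x \<in> C \<Longrightarrow> h x \<in> C"
    "\<And>h k a b p q r s. h \<in> S \<Longrightarrow> Q k a b p q r s \<Longrightarrow> Q k a b (h p) (h q) (h r) (h s)"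
  shows "equivariant S (compose (semiarcs D)) {f. arc_coloring D f}
    (\<lambda>h. map (map h)) {cs. colored D [] cs []}"
  unfolding equivariant_def
proof (intro exI[of _ "lines D"] conjI ballI)
  show "bij_betw (lines D) {f. arc_coloring D f} {cs. colored D [] cs []}"
    unfolding bij_betw_def
  proof (intro conjI set_eqI iffI)
    show "inj_on (lines D) {f. arc_coloring D f}"
      using lines_cancel[OF D] by (auto intro: inj_onI)
    show "cs \<in> {cs. colored D [] cs []}" if "cs \<in> lines D ` {f. arc_coloring D f}" for cs
      using that colored_lines[OF D] by auto
    show "cs \<in> lines D ` {f. arc_coloring D f}" if "cs \<in> {cs. colored D [] cs []}" for cs
    proof -
      from that have "colored D [] cs []" by simp
      from lines_surj[OF virt D this] obtain f where "arc_coloring D f" "lines D f = cs" .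
      then show ?thesis by auto
    qed
  qed
next
  fix h f assume hf: "h \<in> S" "f \<in> {f. arc_coloring D f}"
  have comp: "compose (semiarcs D) h f (semiarc D p) = h (f (semiarc D p))" if "p \<in> points D" for p
    using that by (simp add: compose_def semiarcs_def)
  have "arc_coloring D (compose (semiarcs D) h f)"
    unfolding arc_coloring_def
  proof (intro conjI allI impI)
    show "compose (semiarcs D) h f \<in> semiarcs D \<rightarrow>\<^sub>E C"
      using hf h(1) by (auto simp: arc_coloring_def compose_def)
  next
    fix i l k a b r assume i: "i < length D" and s: "D ! i = (l, Crossing k a b, r)"
    have "(i, length l) \<in> points D" "(i, Suc (length l)) \<in> points D"
      "(Suc i, length l) \<in> points D" "(Suc i, Suc (length l)) \<in> points D"
      using points_bot[OF i] points_top[OF D i] s by auto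
    then show "Q k a b (compose (semiarcs D) h f (semiarc D (i, length l)))
         (compose (semiarcs D) h f (semiarc D (i, Suc (length l))))
         (compose (semiarcs D) h f (semiarc D (Suc i, length l)))
         (compose (semiarcs D) h f (semiarc D (Suc i, Suc (length l))))"
      using hf i s h(2) by (simp add: comp arc_coloring_def)
  qed
  then show "compose (semiarcs D) h f \<in> {f. arc_coloring D f}" by simp
  show "lines D (compose (semiarcs D) h f) = map (map h) (lines D f)"
    unfolding lines_def using points_top[OF D] by (auto simp: comp)
qed

end

section \<open>Local moves\<close>

lemma append_eq_append_split:
  assumes "a @ b = c @ d" "length a \<le> length c" obtains u where "c = a @ u" "b = u @ d"
  using assms by (auto simp: append_eq_append_conv_if intro: that[of "drop (length a) c"])
    (metis append_take_drop_id)

context label_rule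
begin

lemma slice_rel_Nil: "slice_rel ([], e, []) xs ys \<longleftrightarrow> piece_rel e xs ys"
  by (auto simp: slice_rel.simps) (rule exI[of _ "[]"], simp)

lemma slice_rel_Cons:
  "slice_rel (d # l, e, r) xs ys \<longleftrightarrow>
    (\<exists>x xs' ys'. xs = x # xs' \<and> ys = x # ys' \<and> x \<in> C \<and> slice_rel (l, e, r) xs' ys')"
proof -
  have "slice_rel ([d] @ l, e, r @ []) ([x] @ xs' @ []) ys \<longleftrightarrow>
      (\<exists>zs. ys = [x] @ zs @ [] \<and> slice_rel (l, e, r) xs' zs)" if "x \<in> C" for x xs'
    using that by (intro slice_rel_pad) auto
  moreover have "xs \<noteq> [] \<and> hd xs \<in> C" if "slice_rel (d # l, e, r) xs ys"
    using slice_rel_shape[OF that] by (cases xs) auto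
  ultimately show ?thesis by (cases xs) auto
qed

lemma slice_rel_right:
  "slice_rel ([], e, [d]) xs ys \<longleftrightarrow>
    (\<exists>w xs' ys'. xs = xs' @ [w] \<and> ys = ys' @ [w] \<and> w \<in> C \<and> piece_rel e xs' ys')"
    (is "_ \<longleftrightarrow> ?R")
proof
  assume "slice_rel ([], e, [d]) xs ys"
  then obtain xe ye ws where *: "xs = xe @ ws" "ys = ye @ ws" "length ws = 1" "set ws \<subseteq> C" "piece_rel e xe ye"
    by (auto simp: slice_rel.simps)
  moreover from *(3) obtain w where "ws = [w]" by (auto simp: length_Suc_conv)
  ultimately show ?R by auto
next
  assume ?R
  then obtain w xs' ys' where "xs = [] @ xs' @ [w]" "ys = [] @ ys' @ [w]" "w \<in> C" "piece_rel e xs' ys'" by auto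
  then show "slice_rel ([], e, [d]) xs ys"
    unfolding slice_rel.simps
    by (intro exI[of _ "[]"] exI[of _ xs'] exI[of _ ys'] exI[of _ "[w]"]) simp
qed

lemmas slice_rel_simps = slice_rel_Nil slice_rel_Cons slice_rel_right

text \<open>The number of bottom points is read off from the first slice of \<open>T\<close>, since
  \<open>[]\<close> does not show it. In the moves treated here only the right-hand side can be
  empty.\<close>

definition sound :: "tangle \<Rightarrow> tangle \<Rightarrow> bool" where
  "sound T T' \<longleftrightarrow> T \<noteq> [] \<and> interchangeable (length (slice_bot (hd T))) T T'"

text \<open>The two pieces and the strands between them use disjoint parts of the boundary lists.
  Both orders impose the same conditions and differ only in the middle line, which the boundary
  determines.\<close>

lemma sound_exchange_heights:
  "sound [([], e, m @ piece_bot e'), (piece_top e @ m, e', [])]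
     [(piece_bot e @ m, e', []), ([], e, m @ piece_top e')]" (is "sound ?T ?T'")
proof -
  have T: "colored ?T xs cs ys \<longleftrightarrow> (\<exists>xe ye us xe' ye'. xs = xe @ us @ xe' \<and> ys = ye @ us @ ye' \<and>
      cs = [ye @ us @ xe', ye @ us @ ye'] \<and> length us = length m \<and> set us \<subseteq> C \<and>
      piece_rel e xe ye \<and> piece_rel e' xe' ye')" (is "_ \<longleftrightarrow> ?R") for xs cs ys
  proof
    assume "colored ?T xs cs ys"
    then obtain zs where zs: "slice_rel ([], e, m @ piece_bot e') xs zs"
      "slice_rel (piece_top e @ m, e', []) zs ys" "cs = [zs, ys]" by auto
    obtain xe ye ws where 1: "xs = xe @ ws" "zs = ye @ ws" "set ws \<subseteq> C" "piece_rel e xe ye"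
      using zs(1) by (rule slice_relE) simp
    obtain us' xe' ye' where 2: "zs = us' @ xe'" "ys = us' @ ye'"
      "length us' = length (piece_top e) + length m" "set us' \<subseteq> C" "piece_rel e' xe' ye'"
      using zs(2) by (rule slice_relE) simp
    have "length ye = length (piece_top e)" using piece_rel_shape[OF 1(4)] by simp
    with 1(2) 2(1,3) obtain us where "us' = ye @ us" "ws = us @ xe'"
      using append_eq_append_split[of ye ws us' xe'] by auto
    with 1 2 zs(3) \<open>length ye = _\<close> show ?R
      by (intro exI[of _ xe] exI[of _ ye] exI[of _ us] exI[of _ xe'] exI[of _ ye']) auto
  next
    assume ?R
    then obtain xe ye us xe' ye' where *: "xs = xe @ us @ xe'" "ys = ye @ us @ ye'"
      "cs = [ye @ us @ xe', ye @ us @ ye']" "length us = length m" "set us \<subseteq> C"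
      "piece_rel e xe ye" "piece_rel e' xe' ye'" by blast
    note shape = piece_rel_shape[OF *(6)] piece_rel_shape[OF *(7)]
    have "slice_rel ([], e, m @ piece_bot e') ([] @ xe @ (us @ xe')) ([] @ ye @ (us @ xe'))"
      by (rule slice_relI) (use *(4-6) shape in auto)
    moreover have "slice_rel (piece_top e @ m, e', []) ((ye @ us) @ xe' @ []) ((ye @ us) @ ye' @ [])"
      by (rule slice_relI) (use *(4,5,7) shape in auto)
    ultimately show "colored ?T xs cs ys" using *(1-3) by simp
  qed
  have T': "colored ?T' xs cs ys \<longleftrightarrow> (\<exists>xe ye us xe' ye'. xs = xe @ us @ xe' \<and> ys = ye @ us @ ye' \<and>
      cs = [xe @ us @ ye', ye @ us @ ye'] \<and> length us = length m \<and> set us \<subseteq> C \<and>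
      piece_rel e xe ye \<and> piece_rel e' xe' ye')" (is "_ \<longleftrightarrow> ?R") for xs cs ys
  proof
    assume "colored ?T' xs cs ys"
    then obtain zs where zs: "slice_rel (piece_bot e @ m, e', []) xs zs"
      "slice_rel ([], e, m @ piece_top e') zs ys" "cs = [zs, ys]" by auto
    obtain us' xe' ye' where 1: "xs = us' @ xe'" "zs = us' @ ye'"
      "length us' = length (piece_bot e) + length m" "set us' \<subseteq> C" "piece_rel e' xe' ye'"
      using zs(1) by (rule slice_relE) simp
    obtain xe ye ws where 2: "zs = xe @ ws" "ys = ye @ ws" "set ws \<subseteq> C" "piece_rel e xe ye"
      using zs(2) by (rule slice_relE) simp
    have "length xe = length (piece_bot e)" using piece_rel_shape[OF 2(4)] by simp
    with 2(1) 1(2,3) obtain us where "us' = xe @ us" "ws = us @ ye'"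
      using append_eq_append_split[of xe ws us' ye'] by auto
    with 1 2 zs(3) \<open>length xe = _\<close> show ?R
      by (intro exI[of _ xe] exI[of _ ye] exI[of _ us] exI[of _ xe'] exI[of _ ye']) auto
  next
    assume ?R
    then obtain xe ye us xe' ye' where *: "xs = xe @ us @ xe'" "ys = ye @ us @ ye'"
      "cs = [xe @ us @ ye', ye @ us @ ye']" "length us = length m" "set us \<subseteq> C"
      "piece_rel e xe ye" "piece_rel e' xe' ye'" by blast
    note shape = piece_rel_shape[OF *(6)] piece_rel_shape[OF *(7)]
    have "slice_rel (piece_bot e @ m, e', []) ((xe @ us) @ xe' @ []) ((xe @ us) @ ye' @ [])"
      by (rule slice_relI) (use *(4,5,7) shape in auto)
    moreover have "slice_rel ([], e, m @ piece_top e') ([] @ xe @ (us @ ye')) ([] @ ye @ (us @ ye'))"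
      by (rule slice_relI) (use *(4-6) shape in auto)
    ultimately show "colored ?T' xs cs ys" using *(1-3) by simp
  qed
  show ?thesis
    unfolding sound_def interchangeable_def
  proof (intro conjI allI impI)
    fix xs ys
    show "(\<exists>cs. colored ?T xs cs ys) \<longleftrightarrow> (\<exists>cs. colored ?T' xs cs ys)"
      unfolding T T' by blast
    show "cs = cs'" if cols: "colored ?T xs cs ys" "colored ?T xs cs' ys" for cs cs'
    proof -
      obtain xe ye us xe' ye' where 1: "xs = xe @ us @ xe'" "ys = ye @ us @ ye'" "cs = [ye @ us @ xe', ys]"
        "length us = length m" "piece_rel e xe ye" "piece_rel e' xe' ye'"
        using cols(1) unfolding T by blast
      obtain xf yf vs xf' yf' where 2: "xs = xf @ vs @ xf'" "ys = yf @ vs @ yf'" "cs' = [yf @ vs @ xf', ys]"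
        "length vs = length m" "piece_rel e xf yf" "piece_rel e' xf' yf'"
        using cols(2) unfolding T by blast
      have "length xe = length xf" "length ye = length yf"
        using piece_rel_shape[OF 1(5)] piece_rel_shape[OF 2(5)] by simp_all
      then have "xe = xf \<and> us = vs \<and> xe' = xf'" "ye = yf \<and> us = vs \<and> ye' = yf'"
        using 1(1,2,4) 2(1,2,4) by simp_all
      then show ?thesis using 1(3) 2(3) by simp
    qed
    show "cs = cs'" if cols: "colored ?T' xs cs ys" "colored ?T' xs cs' ys" for cs cs'
    proof -
      obtain xe ye us xe' ye' where 1: "xs = xe @ us @ xe'" "ys = ye @ us @ ye'" "cs = [xe @ us @ ye', ys]"
        "length us = length m" "piece_rel e xe ye" "piece_rel e' xe' ye'"
        using cols(1) unfolding T' by blast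
      obtain xf yf vs xf' yf' where 2: "xs = xf @ vs @ xf'" "ys = yf @ vs @ yf'" "cs' = [xf @ vs @ yf', ys]"
        "length vs = length m" "piece_rel e xf yf" "piece_rel e' xf' yf'"
        using cols(2) unfolding T' by blast
      have "length xe = length xf" "length ye = length yf"
        using piece_rel_shape[OF 1(5)] piece_rel_shape[OF 2(5)] by simp_all
      then have "xe = xf \<and> us = vs \<and> xe' = xf'" "ye = yf \<and> us = vs \<and> ye' = yf'"
        using 1(1,2,4) 2(1,2,4) by simp_all
      then show ?thesis using 1(3) 2(3) by simp
    qed
  qed simp
qed

lemma sound_planar_isotopy:
  assumes rotate: "\<And>k a b p q r s. Q (flip k) b (opp a) p q r s \<longleftrightarrow> Q k a b r p s q"
    and "planar_isotopy T T'"
  shows "sound T T'"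
  using assms(2)
proof cases
  case (exchange_heights e m e')
  then show ?thesis using sound_exchange_heights by simp
next
  case (zigzag_right d)
  have "colored T xs cs ys \<longleftrightarrow> (\<exists>x\<in>C. xs = [x] \<and> ys = [x] \<and> cs = [[x, x, x], [x]])" for xs cs ys
    by (auto simp: zigzag_right slice_rel_simps)
  \<comment> \<open>\<open>T'\<close> is unfolded first, so that the characterisation of
    \<open>colored T\<close> still applies; afterwards \<open>T\<close> is unfolded to count its
    bottom points.\<close>
  then show ?thesis unfolding sound_def interchangeable_def
    by (auto simp: zigzag_right(2)) (auto simp: zigzag_right length_Suc_conv)
next
  case (zigzag_left d)
  have "colored T xs cs ys \<longleftrightarrow> (\<exists>x\<in>C. xs = [x] \<and> ys = [x] \<and> cs = [[x, x, x], [x]])" for xs cs ys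
    by (auto simp: zigzag_left slice_rel_simps)
  then show ?thesis unfolding sound_def interchangeable_def
    by (auto simp: zigzag_left(2)) (auto simp: zigzag_left length_Suc_conv)
next
  case (turn_cap k a b)
  have "colored T xs cs ys \<longleftrightarrow> (\<exists>x y z t. xs = [x, y, z] \<and> ys = [t] \<and> cs = [[t, z, z], [t]] \<and> Q k a b x y t z)"
    "colored T' xs cs ys \<longleftrightarrow> (\<exists>x y z t. xs = [x, y, z] \<and> ys = [t] \<and> cs = [[x, x, t], [t]] \<and> Q k a b x y t z)"
    for xs cs ys
    by (auto simp: turn_cap slice_rel_simps rotate dest: Q_carrier)
  then show ?thesis unfolding sound_def interchangeable_def by (auto simp: turn_cap(1))
next
  case (turn_cup b a k)
  \<comment> \<open>The quarter turn read backwards, both \<open>flip\<close> and \<open>opp\<close>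
    being involutions.\<close>
  have rot': "Q (flip k) (opp a) b p q r s \<longleftrightarrow> Q k b a q s p r" for p q r s
    using rotate[of "flip k" b "opp a" q s p r] by simp
  have "colored T xs cs ys \<longleftrightarrow> (\<exists>x y u v. xs = [x] \<and> ys = [u, v, y] \<and> cs = [[x, y, y], [u, v, y]] \<and> Q k b a x y u v)"
    "colored T' xs cs ys \<longleftrightarrow> (\<exists>x y u v. xs = [x] \<and> ys = [u, v, y] \<and> cs = [[u, u, x], [u, v, y]] \<and> Q k b a x y u v)"
    for xs cs ys
    by (auto simp: turn_cup slice_rel_simps rot' dest: Q_carrier)
  then show ?thesis unfolding sound_def interchangeable_def by (auto simp: turn_cup(1))
qed

lemma sound_kink:
  assumes Q: "\<And>d sw se nw ne. Q k d d sw se nw ne \<longleftrightarrow> {sw, se, nw, ne} \<subseteq> C \<and>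
     (case upright d d (sw, se, nw, ne) of (p, q, r, s) \<Rightarrow> side_rel u v p q r s)"
    and "diagonal_switch C u v" "kink k T T'"
  shows "sound T T'"
proof -
  interpret diagonal_switch C u v by fact
  \<comment> \<open>For \<open>d = Down\<close> the crossing becomes upright by a half turn, which
    turns a loop on the right into a loop on the left. Hence both loop lemmas are needed for each
    kink.\<close>
  have right: "(\<exists>y. Q k d d x y z y) \<longleftrightarrow> z = x" if "x \<in> C" for d x z
    using loop_right_iff[OF that, of z] loop_left_iff[OF that] loop_left_iff[of z x] that
    by (cases d) (auto simp: Q)
  have left: "(\<exists>y. Q k d d y x y z) \<longleftrightarrow> z = x" if "x \<in> C" for d x z
    using loop_right_iff[OF that, of z] loop_left_iff[OF that, of z] loop_right_iff[of z x] that
    by (cases d) (auto simp: Q)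
  have right_unique: "y = y'" if "Q k d d x y z y" "Q k d d x y' z y'" for d x y y' z
    using that square_cancel[of y y'] by (cases d) (auto simp: Q side_rel_def)
  have left_unique: "y = y'" if "Q k d d y x y z" "Q k d d y' x y' z" for d x y y' z
    using that square_cancel[of y y'] by (cases d) (auto simp: Q side_rel_def)
  have right_eq: "z = x" if "Q k d d x y z y" for d x y z
    using that right[of x d z] Q_carrier[OF that] by blast
  have left_eq: "z = x" if "Q k d d y x y z" for d x y z
    using that left[of x d z] Q_carrier[OF that] by blast
  from assms(3) show ?thesis
  proof cases
    case (1 d)
    have *: "colored T xs cs ys \<longleftrightarrow> (\<exists>x y z. xs = [x] \<and> ys = [z] \<and> cs = [[x, y, y], [z, y, y], [z]] \<and> Q k d d x y z y)"
      for xs cs ys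
      by (auto simp: 1 slice_rel_simps dest: Q_carrier)
    show ?thesis unfolding sound_def interchangeable_def
    proof (intro conjI allI impI)
      show "T \<noteq> []" by (simp add: 1)
      fix xs ys assume "length xs = length (slice_bot (hd T)) \<and> set xs \<subseteq> C"
      then obtain x where x: "xs = [x]" "x \<in> C" by (auto simp: 1 length_Suc_conv)
      obtain y where "Q k d d x y x y" using right[OF x(2), of d x] by blast
      then show "(\<exists>cs. colored T xs cs ys) \<longleftrightarrow> (\<exists>cs. colored T' xs cs ys)"
        unfolding * x 1(2) by (auto dest: right_eq)
      show "cs = cs'" if "colored T xs cs ys" "colored T xs cs' ys" for cs cs'
        using that unfolding * by (auto dest: right_unique)
      show "cs = cs'" if "colored T' xs cs ys" "colored T' xs cs' ys" for cs cs'
        using that by (simp add: 1(2))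
    qed
  next
    case (2 d)
    have *: "colored T xs cs ys \<longleftrightarrow> (\<exists>x y z. xs = [x] \<and> ys = [z] \<and> cs = [[y, y, x], [y, y, z], [z]] \<and> Q k d d y x y z)"
      for xs cs ys
      by (auto simp: 2 slice_rel_simps dest: Q_carrier)
    show ?thesis unfolding sound_def interchangeable_def
    proof (intro conjI allI impI)
      show "T \<noteq> []" by (simp add: 2)
      fix xs ys assume "length xs = length (slice_bot (hd T)) \<and> set xs \<subseteq> C"
      then obtain x where x: "xs = [x]" "x \<in> C" by (auto simp: 2 length_Suc_conv)
      obtain y where "Q k d d y x y x" using left[OF x(2), of d x] by blast
      then show "(\<exists>cs. colored T xs cs ys) \<longleftrightarrow> (\<exists>cs. colored T' xs cs ys)"
        unfolding * x 2(2) by (auto dest: left_eq)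
      show "cs = cs'" if "colored T xs cs ys" "colored T xs cs' ys" for cs cs'
        using that unfolding * by (auto dest: left_unique)
      show "cs = cs'" if "colored T' xs cs ys" "colored T' xs cs' ys" for cs cs'
        using that by (simp add: 2(2))
    qed
  qed
qed

lemma sound_bigon:
  assumes ud: "\<And>a b p q r s. Q (flip k) b a r s p q \<longleftrightarrow> Q k a b p q r s"
    and det: "\<And>a b. determined C (Q k a b)" "\<And>a b. determined C (Q (flip k) a b)"
    and "bigon k T T'"
  shows "sound T T'"
  using assms(4)
proof cases
  case (1 a b)
  \<comment> \<open>The second crossing is the first one read from top to bottom. Determinacy of the
    flipped kind therefore makes its top labels equal to the bottom labels of the first.\<close>
  have "p' = p \<and> q' = q" if "Q k a b p q r s" "Q k a b p' q' r s" for p q r s p' q'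
    using that determined_unique[OF det(2), of b a r s p q p' q'] Q_carrier[OF that(1)] by (simp add: ud)
  then have *: "colored T xs cs ys \<longleftrightarrow> (\<exists>p q r s. xs = [p, q] \<and> ys = [p, q] \<and> cs = [[r, s], [p, q]] \<and> Q k a b p q r s)"
    for xs cs ys
    by (auto simp: 1 slice_rel_simps ud)
  have ex: "\<exists>r s. Q k a b p q r s" if "p \<in> C" "q \<in> C" for p q
    using determined_exists[OF det(1) that] .
  have un: "r = r' \<and> s = s'" if "Q k a b p q r s" "Q k a b p q r' s'" for p q r s r' s'
    using that determined_unique[OF det(1), of a b p q r s r' s'] Q_carrier[OF that(1)] by simp
  show ?thesis unfolding sound_def interchangeable_def *
    using ex un by (auto simp: 1 length_Suc_conv)
qed

lemma sound_triangle:
  assumes yb: "\<And>a b c. yang_baxter Q k12 k13 k23 a b c"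
    and det: "\<And>k a b. k \<in> {k12, k13, k23} \<Longrightarrow> determined C (Q k a b)"
    and "triangle k12 k13 k23 T T'"
  shows "sound T T'"
  using assms(3)
proof cases
  case (1 a b c)
  have un: "r = r' \<and> s = s'" if "Q k a b p q r s" "Q k a b p q r' s'" "k \<in> {k12, k13, k23}"
    for k a b p q r s r' s'
    using determined_unique[OF det[OF that(3)] that(1,2)] Q_carrier[OF that(1)] by simp
  have T: "colored T xs cs ys \<longleftrightarrow> (\<exists>x1 x2 x3 y1 y2 y3 z1 z2 z3. xs = [x1, x2, x3] \<and> ys = [z3, z2, z1] \<and>
      cs = [[y2, y1, x3], [y2, y3, z1], [z3, z2, z1]] \<and>
      Q k12 a b x1 x2 y2 y1 \<and> Q k13 a c y1 x3 y3 z1 \<and> Q k23 b c y2 y3 z3 z2)" for xs cs ys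
    by (auto simp: 1 slice_rel_simps dest: Q_carrier)
  have T': "colored T' xs cs ys \<longleftrightarrow> (\<exists>x1 x2 x3 y1 y2 y3 z1 z2 z3. xs = [x1, x2, x3] \<and> ys = [z3, z2, z1] \<and>
      cs = [[x1, y3, y2], [z3, y1, y2], [z3, z2, z1]] \<and>
      Q k23 b c x2 x3 y3 y2 \<and> Q k13 a c x1 y3 z3 y1 \<and> Q k12 a b y1 y2 z2 z1)" for xs cs ys
    by (auto simp: 1 slice_rel_simps dest: Q_carrier)
  show ?thesis unfolding sound_def interchangeable_def
  proof (intro conjI allI impI)
    show "T \<noteq> []" by (simp add: 1)
    fix xs ys
    have "(\<exists>cs. colored T xs cs ys) \<longleftrightarrow> (\<exists>x1 x2 x3 z1 z2 z3. xs = [x1, x2, x3] \<and> ys = [z3, z2, z1] \<and>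
        (\<exists>y1 y2 y3. Q k12 a b x1 x2 y2 y1 \<and> Q k13 a c y1 x3 y3 z1 \<and> Q k23 b c y2 y3 z3 z2))"
      by (simp add: T) blast
    also have "\<dots> \<longleftrightarrow> (\<exists>x1 x2 x3 z1 z2 z3. xs = [x1, x2, x3] \<and> ys = [z3, z2, z1] \<and>
        (\<exists>y1 y2 y3. Q k23 b c x2 x3 y3 y2 \<and> Q k13 a c x1 y3 z3 y1 \<and> Q k12 a b y1 y2 z2 z1))"
      using yb[of a b c] by (simp add: yang_baxter_def)
    also have "\<dots> \<longleftrightarrow> (\<exists>cs. colored T' xs cs ys)"
      by (simp add: T') blast
    finally show "(\<exists>cs. colored T xs cs ys) \<longleftrightarrow> (\<exists>cs. colored T' xs cs ys)" .
    show "cs = cs'" if "colored T xs cs ys" "colored T xs cs' ys" for cs cs'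
      using that unfolding T by (auto dest: un)
    show "cs = cs'" if "colored T' xs cs ys" "colored T' xs cs' ys" for cs cs'
      using that unfolding T' by (auto dest: un)
  qed
qed

lemma sound_slide:
  assumes "\<And>k12 k13 k23 a b c. slide_kinds u x k12 k13 k23 \<Longrightarrow> yang_baxter Q k12 k13 k23 a b c"
    and "\<And>k a b. k \<in> {u, flip u, x} \<Longrightarrow> determined C (Q k a b)"
    and "slide u x T T'"
  shows "sound T T'"
  using assms(3)
proof cases
  case strand_1
  show ?thesis by (rule sound_triangle[OF _ _ strand_1]) (auto intro!: assms(1,2) simp: slide_kinds_def)
next
  case strand_2
  show ?thesis by (rule sound_triangle[OF _ _ strand_2]) (auto intro!: assms(1,2) simp: slide_kinds_def)
next
  case strand_3
  show ?thesis by (rule sound_triangle[OF _ _ strand_3]) (auto intro!: assms(1,2) simp: slide_kinds_def)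
qed

lemma sound_swap:
  assumes com: "commute Q j k a b"
    and det: "\<And>a b. determined C (Q j a b)" "\<And>a b. determined C (Q k a b)"
  shows "sound [([], Crossing j a b, []), ([], Crossing k b a, [])]
    [([], Crossing k a b, []), ([], Crossing j b a, [])]" (is "sound ?T ?T'")
proof -
  have un: "r = r' \<and> s = s'" if "Q i a b p q r s" "Q i a b p q r' s'" "i = j \<or> i = k"
    for i a b p q r s r' s'
    using that(3) det determined_unique[of C "Q i a b", OF _ that(1,2)] Q_carrier[OF that(1)] by blast
  have T: "colored [([], Crossing j a b, []), ([], Crossing k b a, [])] xs cs ys \<longleftrightarrow>
      (\<exists>p q m n r s. xs = [p, q] \<and> ys = [r, s] \<and> cs = [[m, n], [r, s]] \<and> Q j a b p q m n \<and> Q k b a m n r s)"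
    for j k xs cs ys
    by (auto simp: slice_rel_simps)
  show ?thesis unfolding sound_def interchangeable_def
  proof (intro conjI allI impI)
    show "?T \<noteq> []" by simp
    fix xs ys
    have ex: "(\<exists>cs. colored [([], Crossing j a b, []), ([], Crossing k b a, [])] xs cs ys) \<longleftrightarrow>
        (\<exists>p q r s. xs = [p, q] \<and> ys = [r, s] \<and> (\<exists>m n. Q j a b p q m n \<and> Q k b a m n r s))" for j k
      by (simp only: T) blast
    show "(\<exists>cs. colored ?T xs cs ys) \<longleftrightarrow> (\<exists>cs. colored ?T' xs cs ys)"
      unfolding ex using com by (simp add: commute_def)
    show "cs = cs'" if "colored ?T xs cs ys" "colored ?T xs cs' ys" for cs cs'
      using that unfolding T by (auto dest: un)
    show "cs = cs'" if "colored ?T' xs cs ys" "colored ?T' xs cs' ys" for cs cs'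
      using that unfolding T by (auto dest: un)
  qed
qed

section \<open>From single moves to equivalence of diagrams\<close>

lemma equivariant_apply_move:
  assumes sound: "\<And>T T'. R T T' \<Longrightarrow> sound T T'" and D: "apply_move K R D D'"
    and h: "\<And>h x. h \<in> S \<Longrightarrow> x \<in> C \<Longrightarrow> h x \<in> C"
    "\<And>h k a b p q r s. h \<in> S \<Longrightarrow> Q k a b p q r s \<Longrightarrow> Q k a b (h p) (h q) (h r) (h s)"
  shows "equivariant S (\<lambda>h. map (map h)) {cs. colored D [] cs []}
    (\<lambda>h. map (map h)) {cs. colored D' [] cs []}"
proof -
  obtain lo hi l r T T' where T: "R T T'" "D = lo @ pad l r T @ hi" "D' = lo @ pad l r T' @ hi"
    using D unfolding apply_move_def by blast
  have "typed D [] []" "typed D' [] []"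
    using D by (auto simp: apply_move_def diagram_def intro: typed_closed_tangle)
  with T sound[OF T(1)] h show ?thesis
    unfolding sound_def by (auto intro: equivariant_local_move)
qed

text \<open>Semiarc colorings enter only at the two ends; all intermediate diagrams are compared
  through labellings of their lines.\<close>

lemma equivariant_equivalent:
  assumes virt: "\<And>a b p q r s. Q Virtual a b p q r s \<Longrightarrow> p = s \<and> q = r"
    and sound: "\<And>T T'. R T T' \<Longrightarrow> sound T T'" and D: "closed_tangle D" "equivclp (apply_move K R) D D'"
    and h: "\<And>h x. h \<in> S \<Longrightarrow> x \<in> C \<Longrightarrow> h x \<in> C"
    "\<And>h k a b p q r s. h \<in> S \<Longrightarrow> Q k a b p q r s \<Longrightarrow> Q k a b (h p) (h q) (h r) (h s)"
  shows "equivariant S (compose (semiarcs D)) {f. arc_coloring D f}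
    (compose (semiarcs D')) {f. arc_coloring D' f}"
proof -
  have eqv: "equivariant S (compose (semiarcs E)) {f. arc_coloring E f} (\<lambda>h. map (map h)) {cs. colored E [] cs []}"
    if "closed_tangle E" for E
    by (rule equivariant_lines) (use virt h that in auto)
  from D(2) have "closed_tangle D' \<and> equivariant S (\<lambda>h. map (map h)) {cs. colored D [] cs []}
    (\<lambda>h. map (map h)) {cs. colored D' [] cs []}"
  proof (induction rule: equivclp_induct)
    case base
    have "equivariant S (compose (semiarcs D)) {f. arc_coloring D f} (\<lambda>h. map (map h)) {cs. colored D [] cs []}"
      using D(1) by (rule eqv)
    \<comment> \<open>Reflexivity includes stability of the labellings under \<open>S\<close>, which
      is obtained by passing to semiarc colorings and back.\<close>
    then show ?case using equivariant_trans[OF equivariant_sym] D(1) by blast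
  next
    case (step D' D'')
    have E: "equivariant S (\<lambda>h. map (map h)) {cs. colored A [] cs []}
        (\<lambda>h. map (map h)) {cs. colored B [] cs []}" if "apply_move K R A B" for A B
      using sound that h by (rule equivariant_apply_move)
    have "closed_tangle D''" using step(2) by (auto simp: apply_move_def diagram_def)
    moreover have "equivariant S (\<lambda>h. map (map h)) {cs. colored D' [] cs []}
        (\<lambda>h. map (map h)) {cs. colored D'' [] cs []}"
      using step(2) E equivariant_sym by blast
    ultimately show ?case using step(3) equivariant_trans by blast
  qed
  moreover have "equivariant S (compose (semiarcs D)) {f. arc_coloring D f} (\<lambda>h. map (map h)) {cs. colored D [] cs []}"
    using D(1) by (rule eqv)
  moreover have "equivariant S (compose (semiarcs D')) {f. arc_coloring D' f} (\<lambda>h. map (map h)) {cs. colored D' [] cs []}"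
    if "closed_tangle D'" using that by (rule eqv)
  ultimately show ?thesis by (meson equivariant_sym equivariant_trans)
qed

end

text \<open>The bijection of vertices, paired with the identity on \<open>S\<close>, maps arcs to
  arcs and respects heads. Parallel arcs stay distinct because each arc carries its
  endomorphism.\<close>

lemma in_degree_polynomial_equivariant:
  assumes "equivariant S (compose (semiarcs D)) V (compose (semiarcs D')) V'"
  shows "in_degree_polynomial (coloring_quiver D V S) = in_degree_polynomial (coloring_quiver D' V' S)"
proof -
  obtain \<beta> where b: "bij_betw \<beta> V V'"
    and e: "\<And>h x. h \<in> S \<Longrightarrow> x \<in> V \<Longrightarrow> compose (semiarcs D) h x \<in> V \<and>
      \<beta> (compose (semiarcs D) h x) = compose (semiarcs D') h (\<beta> x)"
    using assms unfolding equivariant_def by blast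
  have "in_degree (coloring_quiver D V S) f = in_degree (coloring_quiver D' V' S) (\<beta> f)" if f: "f \<in> V" for f
    unfolding in_degree_def
  proof (rule bij_betw_same_card)
    show "bij_betw (map_prod \<beta> id) (in_arcs (coloring_quiver D V S) f) (in_arcs (coloring_quiver D' V' S) (\<beta> f))"
      unfolding bij_betw_def
    proof (intro conjI set_eqI iffI)
      have "inj_on (map_prod \<beta> id) (V \<times> S)"
        using b by (intro map_prod_inj_on) (auto simp: bij_betw_def)
      then show "inj_on (map_prod \<beta> id) (in_arcs (coloring_quiver D V S) f)"
        by (rule inj_on_subset) (auto simp: coloring_quiver_def)
      show "a \<in> in_arcs (coloring_quiver D' V' S) (\<beta> f)"
        if "a \<in> map_prod \<beta> id ` in_arcs (coloring_quiver D V S) f" for a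
        using that e b by (auto simp: coloring_quiver_def bij_betw_def)
      show "a \<in> map_prod \<beta> id ` in_arcs (coloring_quiver D V S) f"
        if a: "a \<in> in_arcs (coloring_quiver D' V' S) (\<beta> f)" for a
      proof -
        obtain g h where g: "a = (\<beta> g, h)" "g \<in> V" "h \<in> S" "compose (semiarcs D') h (\<beta> g) = \<beta> f"
          using a b by (cases a) (auto simp: coloring_quiver_def bij_betw_def)
        have "compose (semiarcs D) h g = f"
          using e[OF g(3,2)] g(4) f b by (auto simp: bij_betw_def dest: inj_onD)
        then show ?thesis using g by (intro image_eqI[of _ _ "(g, h)"]) (auto simp: coloring_quiver_def)
      qed
    qed
  qed
  then show ?thesis
    unfolding in_degree_polynomial_def using sum.reindex_bij_betw[OF b, of "\<lambda>f. monom 1 (in_degree (coloring_quiver D' V' S) f)"]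
    by (simp add: coloring_quiver_def)
qed

section \<open>Colorings by biquandles and psyquandles\<close>

lemma label_rule_crossing: "label_rule (carrier X) (crossing_rel X T)"
  by standard (auto dest: crossing_rel_carrier)

abbreviation "crossing_coloring X T \<equiv> label_rule.arc_coloring (carrier X) (crossing_rel X T)"

abbreviation "crossing_sound X T \<equiv> label_rule.sound (carrier X) (crossing_rel X T)"

lemma crossing_rel_Virtual: "crossing_rel X T Virtual a b p q r s \<Longrightarrow> p = s \<and> q = r"
  by (cases a; cases b) (auto simp: crossing_rel_def side_rel_def)

text \<open>This links the relational form of the rules to the form used for colorings. At a virtual
  crossing the coloring rules are vacuous, while the relation holds because opposite corners lie on
  one semiarc.\<close>

lemma crossing_rel_corners:
  assumes D: "closed_tangle D" "i < length D" "D ! i = (l, Crossing k a b, r)"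
    and f: "f \<in> semiarcs D \<rightarrow>\<^sub>E carrier X"
  shows "crossing_rel X T k a b (f (semiarc D (i, length l))) (f (semiarc D (i, Suc (length l))))
      (f (semiarc D (Suc i, length l))) (f (semiarc D (Suc i, Suc (length l)))) \<longleftrightarrow>
    (\<forall>bl br tl tr. corners D i (length l) a b = (bl, br, tl, tr) \<longrightarrow>
       (k = (if a = b then Over else Under) \<longrightarrow>
          f br = f tl \<rhd>\<^sub>u\<^bsub>X\<^esub> f bl \<and> f tr = f bl \<rhd>\<^sub>o\<^bsub>X\<^esub> f tl) \<and>
       (k = (if a = b then Under else Over) \<longrightarrow>
          f tr = f bl \<rhd>\<^sub>u\<^bsub>X\<^esub> f tl \<and> f br = f tl \<rhd>\<^sub>o\<^bsub>X\<^esub> f bl) \<and>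
       (k \<in> {Singular, Precrossing} \<longrightarrow> T (f bl) (f br) (f tl) (f tr)))"
proof -
  have "(i, length l) \<in> points D" "(i, Suc (length l)) \<in> points D"
    "(Suc i, length l) \<in> points D" "(Suc i, Suc (length l)) \<in> points D"
    using points_bot[OF D(2)] points_top[OF D(1,2)] D(3) by auto
  then have "f (semiarc D (i, length l)) \<in> carrier X" "f (semiarc D (i, Suc (length l))) \<in> carrier X"
    "f (semiarc D (Suc i, length l)) \<in> carrier X" "f (semiarc D (Suc i, Suc (length l))) \<in> carrier X"
    using f by (auto simp: semiarcs_def)
  moreover have "k = Virtual \<Longrightarrow> semiarc D (i, length l) = semiarc D (Suc i, Suc (length l))"
    "k = Virtual \<Longrightarrow> semiarc D (i, Suc (length l)) = semiarc D (Suc i, length l)"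
    using semiarc_joined[OF joined.virtual_sw_ne, of i D] semiarc_joined[OF joined.virtual_se_nw, of i D] D
    by auto
  ultimately show ?thesis
    unfolding crossing_rel_def corners_def side_rel_def
    by (cases k; cases a; cases b) auto
qed

lemma crossing_coloring_iff:
  assumes D: "closed_tangle D"
  shows "crossing_coloring X T D f \<longleftrightarrow> biq_coloring X D f \<and>
    (\<forall>i l k a b r bl br tl tr.
       i < length D \<and> D ! i = (l, Crossing k a b, r) \<and> k \<in> {Singular, Precrossing} \<and>
       corners D i (length l) a b = (bl, br, tl, tr) \<longrightarrow> T (f bl) (f br) (f tl) (f tr))"
proof (intro iffI conjI; (elim conjE)?)
  assume "crossing_coloring X T D f"
  then have f: "f \<in> semiarcs D \<rightarrow>\<^sub>E carrier X"
    and rel: "\<And>i l k a b r. i < length D \<Longrightarrow> D ! i = (l, Crossing k a b, r) \<Longrightarrow>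
      crossing_rel X T k a b (f (semiarc D (i, length l))) (f (semiarc D (i, Suc (length l))))
        (f (semiarc D (Suc i, length l))) (f (semiarc D (Suc i, Suc (length l))))"
    unfolding label_rule.arc_coloring_def[OF label_rule_crossing] by blast+
  have "(k = (if a = b then Over else Under) \<longrightarrow>
          f br = f tl \<rhd>\<^sub>u\<^bsub>X\<^esub> f bl \<and> f tr = f bl \<rhd>\<^sub>o\<^bsub>X\<^esub> f tl) \<and>
       (k = (if a = b then Under else Over) \<longrightarrow>
          f tr = f bl \<rhd>\<^sub>u\<^bsub>X\<^esub> f tl \<and> f br = f tl \<rhd>\<^sub>o\<^bsub>X\<^esub> f bl)"
    if "i < length D \<and> D ! i = (l, Crossing k a b, r) \<and> corners D i (length l) a b = (bl, br, tl, tr)"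
    for i l k a b r bl br tl tr
    using that rel[of i l k a b r] crossing_rel_corners[OF D _ _ f, of i l k a b r T] by blast
  then show "biq_coloring X D f"
    unfolding biq_coloring_def by (intro conjI[OF f] allI impI)
  have "T (f bl) (f br) (f tl) (f tr)"
    if "i < length D \<and> D ! i = (l, Crossing k a b, r) \<and> k \<in> {Singular, Precrossing} \<and>
      corners D i (length l) a b = (bl, br, tl, tr)"
    for i l k a b r bl br tl tr
    using that rel[of i l k a b r] crossing_rel_corners[OF D _ _ f, of i l k a b r T] by blast
  then show "\<forall>i l k a b r bl br tl tr.
       i < length D \<and> D ! i = (l, Crossing k a b, r) \<and> k \<in> {Singular, Precrossing} \<and>
       corners D i (length l) a b = (bl, br, tl, tr) \<longrightarrow> T (f bl) (f br) (f tl) (f tr)"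
    by (intro allI impI)
next
  assume biq: "biq_coloring X D f" and bul: "\<forall>i l k a b r bl br tl tr.
       i < length D \<and> D ! i = (l, Crossing k a b, r) \<and> k \<in> {Singular, Precrossing} \<and>
       corners D i (length l) a b = (bl, br, tl, tr) \<longrightarrow> T (f bl) (f br) (f tl) (f tr)"
  have f: "f \<in> semiarcs D \<rightarrow>\<^sub>E carrier X" using biq by (simp add: biq_coloring_def)
  have tri: "(k = (if a = b then Over else Under) \<longrightarrow>
          f br = f tl \<rhd>\<^sub>u\<^bsub>X\<^esub> f bl \<and> f tr = f bl \<rhd>\<^sub>o\<^bsub>X\<^esub> f tl) \<and>
       (k = (if a = b then Under else Over) \<longrightarrow>
          f tr = f bl \<rhd>\<^sub>u\<^bsub>X\<^esub> f tl \<and> f br = f tl \<rhd>\<^sub>o\<^bsub>X\<^esub> f bl)"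
    if "i < length D" "D ! i = (l, Crossing k a b, r)" "corners D i (length l) a b = (bl, br, tl, tr)"
    for i l k a b r bl br tl tr
    using biq[unfolded biq_coloring_def, THEN conjunct2] that by blast
  have "crossing_rel X T k a b (f (semiarc D (i, length l))) (f (semiarc D (i, Suc (length l))))
        (f (semiarc D (Suc i, length l))) (f (semiarc D (Suc i, Suc (length l))))"
    if i: "i < length D" "D ! i = (l, Crossing k a b, r)" for i l k a b r
    unfolding crossing_rel_corners[OF D i f, of T] using tri[OF i] bul i by blast
  with f show "crossing_coloring X T D f"
    unfolding label_rule.arc_coloring_def[OF label_rule_crossing] by blast
qed

lemma biq_coloring_iff:
  "closed_tangle D \<Longrightarrow> biq_coloring X D f \<longleftrightarrow> crossing_coloring X (\<lambda>_ _ _ _. True) D f"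
  by (simp add: crossing_coloring_iff)

lemma psyq_coloring_iff:
  "closed_tangle D \<Longrightarrow> psyq_coloring X D f \<longleftrightarrow> crossing_coloring X (bul_rel X) D f"
  by (simp only: psyq_coloring_def crossing_coloring_iff side_rel_def)

lemma hom_crossing_rel:
  assumes h: "h \<in> biq_hom X X"
    and T: "\<And>p q r s. \<lbrakk>p \<in> carrier X; q \<in> carrier X; r \<in> carrier X; s \<in> carrier X; T p q r s\<rbrakk> \<Longrightarrow>
      T (h p) (h q) (h r) (h s)"
    and rel: "crossing_rel X T k a b p q r s"
  shows "crossing_rel X T k a b (h p) (h q) (h r) (h s)"
proof -
  have in_carrier: "h p \<in> carrier X" "h q \<in> carrier X" "h r \<in> carrier X" "h s \<in> carrier X"
    using crossing_rel_carrier[OF rel] h by (auto simp: biq_hom_def)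
  have op: "h (utri X x y) = utri X (h x) (h y)" "h (otri X x y) = otri X (h x) (h y)"
    if "x \<in> carrier X" "y \<in> carrier X" for x y
    using that h by (auto simp: biq_hom_def)
  show ?thesis
    using rel in_carrier T
    by (cases k; cases a; cases b) (auto simp: crossing_rel_def side_rel_def op)
qed

lemma in_degree_polynomial_biq_quiver:
  assumes S: "S \<subseteq> biq_hom X X" and D: "closed_tangle D" "closed_tangle D'"
    and sound: "\<And>T T'. R T T' \<Longrightarrow> crossing_sound X (\<lambda>_ _ _ _. True) T T'"
    and "equivclp (apply_move K R) D D'"
  shows "in_degree_polynomial (biq_quiver X S D) = in_degree_polynomial (biq_quiver X S D')"
proof -
  have "h x \<in> carrier X" if "h \<in> S" "x \<in> carrier X" for h x
    using S that by (auto simp: biq_hom_def)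
  moreover have "crossing_rel X (\<lambda>_ _ _ _. True) k a b (h p) (h q) (h r) (h s)"
    if "h \<in> S" "crossing_rel X (\<lambda>_ _ _ _. True) k a b p q r s" for h k a b p q r s
    using S that by (intro hom_crossing_rel[OF _ _ that(2)]) auto
  ultimately have "equivariant S (compose (semiarcs D)) {f. crossing_coloring X (\<lambda>_ _ _ _. True) D f}
    (compose (semiarcs D')) {f. crossing_coloring X (\<lambda>_ _ _ _. True) D' f}"
    by (intro label_rule.equivariant_equivalent[OF label_rule_crossing crossing_rel_Virtual sound D(1) assms(5)]) blast+
  then show ?thesis
    unfolding biq_quiver_def biq_coloring_iff[OF D(1)] biq_coloring_iff[OF D(2)]
    by (rule in_degree_polynomial_equivariant)
qed

lemma in_degree_polynomial_psyq_quiver: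
  assumes S: "S \<subseteq> psyq_hom X X" and D: "closed_tangle D" "closed_tangle D'"
    and sound: "\<And>T T'. R T T' \<Longrightarrow> crossing_sound X (bul_rel X) T T'"
    and "equivclp (apply_move K R) D D'"
  shows "in_degree_polynomial (psyq_quiver X S D) = in_degree_polynomial (psyq_quiver X S D')"
proof -
  have "h x \<in> carrier X" if "h \<in> S" "x \<in> carrier X" for h x
    using S that by (auto simp: psyq_hom_def biq_hom_def)
  moreover have "crossing_rel X (bul_rel X) k a b (h p) (h q) (h r) (h s)"
    if h: "h \<in> S" and "crossing_rel X (bul_rel X) k a b p q r s" for h k a b p q r s
    by (rule hom_crossing_rel[OF _ _ that(2)]) (use S h in \<open>auto simp: psyq_hom_def side_rel_def\<close>)
  ultimately have "equivariant S (compose (semiarcs D)) {f. crossing_coloring X (bul_rel X) D f}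
    (compose (semiarcs D')) {f. crossing_coloring X (bul_rel X) D' f}"
    by (intro label_rule.equivariant_equivalent[OF label_rule_crossing crossing_rel_Virtual sound D(1) assms(5)]) blast+
  then show ?thesis
    unfolding psyq_quiver_def psyq_coloring_iff[OF D(1)] psyq_coloring_iff[OF D(2)]
    by (rule in_degree_polynomial_equivariant)
qed

lemma sound_planar: "planar_isotopy T T' \<Longrightarrow> crossing_sound X B T T'"
  by (rule label_rule.sound_planar_isotopy[OF label_rule_crossing crossing_rel_rotate])

lemma (in finite_biquandle) sound_classical:
  assumes "classical_move T T'"
  shows "crossing_sound X B T T'"
  using assms
proof cases
  case (R1 k)
  from R1(1) show ?thesis
  proof (elim insertE emptyE)
    assume [simp]: "k = Over"
    \<comment> \<open>The strands of a kink's crossing are parallel, and an over-crossing of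
      parallel strands has the overlined operation first; hence the exchanged switch.\<close>
    show ?thesis
      by (rule label_rule.sound_kink[OF label_rule_crossing _ tri.diagonal_switch_swap R1(2)]) (simp add: crossing_rel_def)
  next
    assume [simp]: "k = Under"
    show ?thesis
      by (rule label_rule.sound_kink[OF label_rule_crossing _ tri.diagonal_switch_axioms R1(2)]) (simp add: crossing_rel_def)
  qed
next
  case (R2 k)
  show ?thesis
    by (rule label_rule.sound_bigon[OF label_rule_crossing crossing_rel_upside_down _ _ R2(2)])
      (use R2(1) in \<open>auto intro!: determined_classical\<close>)
next
  case (R3 u x)
  show ?thesis
    by (rule label_rule.sound_slide[OF label_rule_crossing yang_baxter_classical[OF R3(1,2)] _ R3(3)])
      (use R3(1,2) in \<open>auto intro!: determined_classical\<close>)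
qed

lemma (in finite_biquandle) sound_virtual:
  assumes "virtual_move T T'"
  shows "crossing_sound X B T T'"
proof -
  have det: "determined (carrier X) (crossing_rel X B k a b)" if "k \<in> {Over, Under, Virtual}" for k a b
    using that determined_classical determined_virtual by blast
  from assms show ?thesis
  proof cases
    case V1
    \<comment> \<open>A virtual crossing is the switch of the two projections, for which the square
      of \<open>x\<close> is \<open>x\<close>.\<close>
    have sw: "diagonal_switch (carrier X) (\<lambda>x y. x) (\<lambda>x y. x)"
      by (simp add: diagonal_switch_def diagonal_switch_axioms_def switch_trivial finite_carrier)
    show ?thesis
      by (rule label_rule.sound_kink[OF label_rule_crossing _ sw V1]) (simp add: crossing_rel_def)
  next
    case V2
    show ?thesis
      by (rule label_rule.sound_bigon[OF label_rule_crossing crossing_rel_upside_down _ _ V2]) (simp_all add: det)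
  next
    case (V3 x)
    show ?thesis
      by (rule label_rule.sound_slide[OF label_rule_crossing yang_baxter_virtual _ V3(2)]) (use V3(1) in \<open>auto intro!: det\<close>)
  qed
qed

context finite_psyquandle
begin

lemma sound_transverse:
  assumes s: "s \<in> {Singular, Precrossing}" and "transverse_move s T T'"
  shows "crossing_sound X (bul_rel X) T T'"
proof -
  have det: "determined (carrier X) (crossing_rel X (bul_rel X) k a b)"
    if "k \<in> {Over, Under, s}" for k a b
    using that s determined_classical determined_bul by blast
  from assms(2) show ?thesis
  proof cases
    case (slide u)
    show ?thesis
      by (rule label_rule.sound_slide[OF label_rule_crossing yang_baxter_bul[OF slide(1) s] _ slide(2)])
        (use slide(1) in \<open>auto intro!: det\<close>)
  next
    case (swap k a b)
    show ?thesis unfolding swap(1,2)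
      by (rule label_rule.sound_swap[OF label_rule_crossing commute_bul[OF s swap(3)]]) (use swap(3) in \<open>auto intro!: det\<close>)
  qed
qed

end

theorem corollary4:
  "(\<forall>(X :: 'a psyq) S D D'.
      psyquandle X \<and> finite (carrier X) \<and> S \<subseteq> psyq_hom X X \<and>
      singular_diagram D \<and> singular_diagram D' \<and> singular_equivalent D D' \<longrightarrow>
      in_degree_polynomial (psyq_quiver X S D) = in_degree_polynomial (psyq_quiver X S D'))
   \<and>
   (\<forall>(X :: 'b psyq) S D D'.
      pI_adequate_psyquandle X \<and> finite (carrier X) \<and> S \<subseteq> psyq_hom X X \<and>
      pseudo_diagram D \<and> pseudo_diagram D' \<and> pseudo_equivalent D D' \<longrightarrow>
      in_degree_polynomial (psyq_quiver X S D) = in_degree_polynomial (psyq_quiver X S D'))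
   \<and>
   (\<forall>(X :: 'c biq) S D D'.
      biquandle X \<and> finite (carrier X) \<and> S \<subseteq> biq_hom X X \<and>
      (classical_diagram D \<and> classical_diagram D' \<and> classical_equivalent D D' \<or>
       virtual_diagram D \<and> virtual_diagram D' \<and> virtual_equivalent D D') \<longrightarrow>
      in_degree_polynomial (biq_quiver X S D) = in_degree_polynomial (biq_quiver X S D'))"
proof (intro conjI allI impI; elim conjE)
  fix X :: "'a psyq" and S D D'
  assume X: "psyquandle X" "finite (carrier X)" and S: "S \<subseteq> psyq_hom X X"
    and D: "singular_diagram D" "singular_diagram D'" "singular_equivalent D D'"
  interpret finite_psyquandle X
    using X by (intro finite_psyquandle.intro finite_biquandle.intro finite_biquandle_axioms.intro
        psyquandle.axioms(1))
  have D': "closed_tangle D" "closed_tangle D'"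
    using D(1,2) by (simp_all add: diagram_def)
  show "in_degree_polynomial (psyq_quiver X S D) = in_degree_polynomial (psyq_quiver X S D')"
    using S D' _ D(3)[unfolded singular_equivalent_def]
    by (rule in_degree_polynomial_psyq_quiver)
      (use sound_planar sound_classical sound_transverse[of Singular] in blast)
next
  fix X :: "'b psyq" and S D D'
  assume X: "pI_adequate_psyquandle X" "finite (carrier X)" and S: "S \<subseteq> psyq_hom X X"
    and D: "pseudo_diagram D" "pseudo_diagram D'" "pseudo_equivalent D D'"
  interpret pI_adequate_psyquandle X by (rule X(1))
  interpret finite_psyquandle X
    using X(2) by (intro finite_psyquandle.intro finite_biquandle.intro finite_biquandle_axioms.intro
        psyquandle_axioms biquandle_axioms)
  \<comment> \<open>pI-adequacy is the diagonal condition for the bullet operations, so the kink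
    argument for classical crossings applies verbatim to precrossings.\<close>
  have sw: "diagonal_switch (carrier X) (ubul X) (obul X)"
    using bul_switch bul_diag X(2) by (simp add: diagonal_switch_def diagonal_switch_axioms_def)
  have kink: "crossing_sound X (bul_rel X) T T'" if "kink Precrossing T T'" for T T'
    by (rule label_rule.sound_kink[OF label_rule_crossing _ sw that]) (simp add: crossing_rel_def)
  have D': "closed_tangle D" "closed_tangle D'"
    using D(1,2) by (simp_all add: diagram_def)
  show "in_degree_polynomial (psyq_quiver X S D) = in_degree_polynomial (psyq_quiver X S D')"
    using S D' _ D(3)[unfolded pseudo_equivalent_def]
    by (rule in_degree_polynomial_psyq_quiver)
      (use sound_planar sound_classical sound_transverse[of Precrossing] kink in blast)
next
  fix X :: "'c biq" and S D D'
  assume X: "biquandle X" "finite (carrier X)" and S: "S \<subseteq> biq_hom X X"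
    and D: "classical_diagram D \<and> classical_diagram D' \<and> classical_equivalent D D' \<or>
       virtual_diagram D \<and> virtual_diagram D' \<and> virtual_equivalent D D'"
  interpret finite_biquandle X
    using X by (simp add: finite_biquandle_def finite_biquandle_axioms_def)
  have D': "closed_tangle D" "closed_tangle D'"
    using D by (auto simp: diagram_def)
  from D show "in_degree_polynomial (biq_quiver X S D) = in_degree_polynomial (biq_quiver X S D')"
  proof (elim disjE conjE)
    assume E: "classical_equivalent D D'"
    show ?thesis
      using S D' _ E[unfolded classical_equivalent_def]
      by (rule in_degree_polynomial_biq_quiver) (use sound_planar sound_classical in blast)
  next
    assume E: "virtual_equivalent D D'"
    show ?thesis
      using S D' _ E[unfolded virtual_equivalent_def]
      by (rule in_degree_polynomial_biq_quiver) (use sound_planar sound_classical sound_virtual in blast)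
  qed
qed

end
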